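(* Let $F=L_1(x)+L_2(y)+a\in\mathcal F\{x,y\}\setminus\mathcal F$ with $L_1,L_2\in\mathcal F[\delta]$ and $a\in\mathcal F$. Then the differential curve $(\mathcal C,F)$ is unirational if and only if $\mathrm{gcld}(L_1,L_2)=1$. Furthermore, each unirational linear differential curve has a proper linear differential polynomial parametrization.
   Context: $\mathcal F$ is an ordinary differential field of characteristic $0$ with derivation $\delta$, and $\mathcal E$ is a fixed universal differential extension field of $\mathcal F$; $x,y$ are differential indeterminates over $\mathcal E$, and $u\in\mathcal E$ is differentially transcendental over $\mathcal F$. $\mathcal F\{S\}$ and $\mathcal F\langle S\rangle$ denote the differential ring and differential field generated by $S$ over $\mathcal F$. $\mathcal F[\delta]$ is the (in general non-commutative) ring of linear differential operators over $\mathcal F$. $L_2$ is a left divisor of $L_1$ if $L_1=L_2Q$ for some $Q\in\mathcal F[\delta]$. $\mathrm{gcld}(L_1,L_2)$ denotes the unique monic common left divisor of $L_1,L_2$ of highest degree (in $\delta$). Differential curves: for an irreducible $A\in\mathcal F\{x,y\}\setminus\mathcal F$, $\mathrm{sat}(A)=[A]:S_A^\infty=\{f:\exists m,\ S_A^mf\in[A]\}$, where $[A]$ is the differential ideal generated by $A$ and $S_A$ is the separant of $A$ (the partial derivative of $A$ with respect to its leader) under some ranking; it is a prime differential ideal independent of the ranking. $(\mathcal C,A)$ denotes the irreducible (plane) differential curve $\mathcal C=\mathbb V(\mathrm{sat}(A))\subset\mathbb A^2(\mathcal E)$, and it is called a linear differential curve if $A$ is a linear differential polynomial (degree $1$, possibly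 with a constant term). $\mathcal C$ is unirational if it has a generic point $\mathcal P(u)=\big(\frac{P_1(u)}{Q_1(u)},\frac{P_2(u)}{Q_2(u)}\big)\in\mathcal F\langle u\rangle^2$, i.e. the set $\mathbb I(\mathcal P(u))$ of differential polynomials in $\mathcal F\{x,y\}$ vanishing at $\mathcal P(u)$ equals $\mathrm{sat}(A)$; such $\mathcal P(u)$ (with $P_i,Q_i\in\mathcal F\{u\}$, $\gcd(P_i,Q_i)=1$) is called a differential rational parametrization of $\mathcal C$. It is proper if $\mathcal F\langle \frac{P_1(u)}{Q_1(u)},\frac{P_2(u)}{Q_2(u)}\rangle=\mathcal F\langle u\rangle$. It is a linear differential polynomial parametrization if $\mathcal P(u)=(P_1(u),P_2(u))\in\mathcal F\{u\}^2$ with $P_1,P_2$ of degree at most $1$. *)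

theory Defs
  imports
    "HOL-Library.Poly_Mapping"
    "HOL-Computational_Algebra.Polynomial"
    "HOL-Computational_Algebra.Factorial_Ring"
    "HOL-Algebra.Ring"
begin

section \<open>Ordinary differential fields of characteristic 0\<close>

class differential_field = field_char_0 +
  fixes der :: "'a \<Rightarrow> 'a"
  assumes der_add: "der (a + b) = der a + der b"
    and der_mult: "der (a * b) = der a * b + a * der b"

text \<open>
  A differential extension field of \<open>'f\<close> is a differential field \<open>'e\<close> together with a
  differential embedding \<open>\<iota>\<close>, which plays the role of the inclusion.
\<close>

definition diff_embedding :: "('f::differential_field \<Rightarrow> 'e::differential_field) \<Rightarrow> bool" where
  "diff_embedding \<iota> \<longleftrightarrow>
     \<iota> 1 = 1 \<and> (\<forall>a b. \<iota> (a + b) = \<iota> a + \<iota> b) \<and> (\<forall>a b. \<iota> (a * b) = \<iota> a * \<iota> b) \<and>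
     (\<forall>a. \<iota> (der a) = der (\<iota> a))"

definition diff_subfield :: "'e::differential_field set \<Rightarrow> bool" where
  "diff_subfield K \<longleftrightarrow>
     0 \<in> K \<and> 1 \<in> K \<and> (\<forall>a\<in>K. \<forall>b\<in>K. a + b \<in> K \<and> a * b \<in> K) \<and>
     (\<forall>a\<in>K. - a \<in> K \<and> inverse a \<in> K \<and> der a \<in> K)"

text \<open>\<open>adjoin \<iota> S\<close> is the differential field generated by \<open>S\<close> over the base field.\<close>

definition adjoin :: "('f::differential_field \<Rightarrow> 'e::differential_field) \<Rightarrow> 'e set \<Rightarrow> 'e set" where
  "adjoin \<iota> S = \<Inter>{K. diff_subfield K \<and> range \<iota> \<union> S \<subseteq> K}"

text \<open>
  \<open>R\<close>, with derivation \<open>D\<close>, is a differential extension field of the differential subfield \<open>K\<close>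
  via the embedding \<open>h\<close>, and it is generated as such by finitely many elements. Here \<open>R\<close> need not
  lie in the ambient field: its carrier is just a set with its own field operations.
\<close>

definition fin_gen_diff_extension ::
  "'e::differential_field set \<Rightarrow> 'b ring \<Rightarrow> ('b \<Rightarrow> 'b) \<Rightarrow> ('e \<Rightarrow> 'b) \<Rightarrow> bool" where
  "fin_gen_diff_extension K R D h \<longleftrightarrow>
     field R \<and>
     D \<in> carrier R \<rightarrow> carrier R \<and>
     (\<forall>a\<in>carrier R. \<forall>b\<in>carrier R.
        D (a \<oplus>\<^bsub>R\<^esub> b) = D a \<oplus>\<^bsub>R\<^esub> D b \<and>
        D (a \<otimes>\<^bsub>R\<^esub> b) = D a \<otimes>\<^bsub>R\<^esub> b \<oplus>\<^bsub>R\<^esub> a \<otimes>\<^bsub>R\<^esub> D b) \<and>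
     h \<in> K \<rightarrow> carrier R \<and> h 1 = \<one>\<^bsub>R\<^esub> \<and>
     (\<forall>a\<in>K. \<forall>b\<in>K. h (a + b) = h a \<oplus>\<^bsub>R\<^esub> h b \<and> h (a * b) = h a \<otimes>\<^bsub>R\<^esub> h b) \<and>
     (\<forall>a\<in>K. h (der a) = D (h a)) \<and>
     (\<exists>T. finite T \<and> T \<subseteq> carrier R \<and>
        (\<forall>M. h ` K \<union> T \<subseteq> M \<and> M \<subseteq> carrier R \<and> field (R\<lparr>carrier := M\<rparr>) \<and> D ` M \<subseteq> M
             \<longrightarrow> M = carrier R))"

text \<open>
  \<open>'e\<close> is universal over \<open>'f\<close>: for every finitely generated differential extension \<open>F1\<close> of the base
  field inside \<open>'e\<close>, every finitely generated differential extension field \<open>R\<close> of \<open>F1\<close>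
  embeds differentially into \<open>'e\<close> over \<open>F1\<close>. Taking the carrier of \<open>R\<close> among the subsets of the type
  \<open>'e\<close> loses nothing up to isomorphism: \<open>F1\<close> is infinite, so \<open>R\<close> has the same cardinality as \<open>F1\<close>.
\<close>

definition universal_extension ::
  "('f::differential_field \<Rightarrow> 'e::differential_field) \<Rightarrow> bool" where
  "universal_extension \<iota> \<longleftrightarrow>
     diff_embedding \<iota> \<and>
     (\<forall>S (R :: 'e ring) D h. finite S \<and> fin_gen_diff_extension (adjoin \<iota> S) R D h \<longrightarrow>
        (\<exists>g. g \<one>\<^bsub>R\<^esub> = 1 \<and>
             (\<forall>a\<in>carrier R. \<forall>b\<in>carrier R.
                g (a \<oplus>\<^bsub>R\<^esub> b) = g a + g b \<and> g (a \<otimes>\<^bsub>R\<^esub> b) = g a * g b) \<and>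
             (\<forall>a\<in>carrier R. g (D a) = der (g a)) \<and>
             (\<forall>a\<in>adjoin \<iota> S. g (h a) = a)))"


section \<open>Differential polynomials\<close>

text \<open>
  \<open>('v, 'a) dpoly\<close> is the differential polynomial ring over \<open>'a\<close> in the differential
  indeterminates \<open>'v\<close>: ordinary polynomials in the variables \<open>(v, k)\<close>, where \<open>(v, k)\<close> stands for the
  \<open>k\<close>-th derivative of \<open>v\<close>.
\<close>

type_synonym ('v, 'a) dpoly = "(('v \<times> nat) \<Rightarrow>\<^sub>0 nat) \<Rightarrow>\<^sub>0 'a"

definition dconst :: "'a \<Rightarrow> ('v, 'a::zero) dpoly" where
  "dconst c = Poly_Mapping.single 0 c"

definition dvar :: "'v \<times> nat \<Rightarrow> ('v, 'a::zero_neq_one) dpoly" where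
  "dvar w = Poly_Mapping.single (Poly_Mapping.single w 1) 1"

definition dvars :: "('v, 'a::zero) dpoly \<Rightarrow> ('v \<times> nat) set" where
  "dvars p = (\<Union>m\<in>Poly_Mapping.keys p. Poly_Mapping.keys m)"

definition total_degree :: "('v, 'a::zero) dpoly \<Rightarrow> nat" where
  "total_degree p =
     Max (insert 0 ((\<lambda>m. \<Sum>w\<in>Poly_Mapping.keys m. Poly_Mapping.lookup m w) ` Poly_Mapping.keys p))"

definition partial_deriv ::
  "'v \<times> nat \<Rightarrow> ('v, 'a::comm_semiring_1) dpoly \<Rightarrow> ('v, 'a) dpoly" where
  "partial_deriv w p =
     (\<Sum>m\<in>Poly_Mapping.keys p.
        Poly_Mapping.single (m - Poly_Mapping.single w 1)
          (of_nat (Poly_Mapping.lookup m w) * Poly_Mapping.lookup p m))"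

text \<open>The derivation of the differential polynomial ring: it extends the derivation of the
  coefficient field and maps \<open>(v, k)\<close> to \<open>(v, k + 1)\<close>.\<close>

definition dpoly_der :: "('v, 'a::differential_field) dpoly \<Rightarrow> ('v, 'a) dpoly" where
  "dpoly_der p =
     (\<Sum>m\<in>Poly_Mapping.keys p. Poly_Mapping.single m (der (Poly_Mapping.lookup p m))) +
     (\<Sum>w\<in>dvars p. partial_deriv w p * dvar (fst w, Suc (snd w)))"

definition dpoly_eval ::
  "('f \<Rightarrow> 'e) \<Rightarrow> ('v \<Rightarrow> 'e) \<Rightarrow> ('v, 'f::differential_field) dpoly \<Rightarrow> 'e::differential_field" where
  "dpoly_eval \<iota> \<eta> p =
     (\<Sum>m\<in>Poly_Mapping.keys p. \<iota> (Poly_Mapping.lookup p m) *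
        (\<Prod>w\<in>Poly_Mapping.keys m. ((der ^^ snd w) (\<eta> (fst w))) ^ Poly_Mapping.lookup m w))"

definition vanishing_ideal ::
  "('f::differential_field \<Rightarrow> 'e::differential_field) \<Rightarrow> ('v \<Rightarrow> 'e) \<Rightarrow> ('v, 'f) dpoly set" where
  "vanishing_ideal \<iota> \<eta> = {p. dpoly_eval \<iota> \<eta> p = 0}"

definition diff_transcendental ::
  "('f::differential_field \<Rightarrow> 'e::differential_field) \<Rightarrow> 'e \<Rightarrow> bool" where
  "diff_transcendental \<iota> u \<longleftrightarrow>
     (\<forall>p :: (unit, 'f) dpoly. dpoly_eval \<iota> (\<lambda>_. u) p = 0 \<longrightarrow> p = 0)"


section \<open>The ideal sat(A)\<close>

definition diff_ideal :: "('v, 'a::differential_field) dpoly set \<Rightarrow> bool" where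
  "diff_ideal I \<longleftrightarrow>
     0 \<in> I \<and> (\<forall>p\<in>I. \<forall>q\<in>I. p + q \<in> I) \<and> (\<forall>p\<in>I. \<forall>q. q * p \<in> I) \<and> (\<forall>p\<in>I. dpoly_der p \<in> I)"

definition diff_ideal_gen ::
  "('v, 'a::differential_field) dpoly set \<Rightarrow> ('v, 'a) dpoly set" where
  "diff_ideal_gen S = \<Inter>{I. diff_ideal I \<and> S \<subseteq> I}"

text \<open>A ranking: a total order on the derivatives of the indeterminates with \<open>w < \<delta> w\<close>, and
  \<open>\<delta> w \<le> \<delta> w'\<close> whenever \<open>w \<le> w'\<close>. A pair \<open>(w, w')\<close> in \<open>r\<close> means \<open>w \<le> w'\<close>.\<close>

definition ranking :: "('v \<times> nat) rel \<Rightarrow> bool" where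
  "ranking r \<longleftrightarrow>
     linear_order r \<and>
     (\<forall>v k. ((v, k), (v, Suc k)) \<in> r) \<and>
     (\<forall>v k v' k'. ((v, k), (v', k')) \<in> r \<longrightarrow> ((v, Suc k), (v', Suc k')) \<in> r)"

definition leader :: "('v \<times> nat) rel \<Rightarrow> ('v, 'a::zero) dpoly \<Rightarrow> 'v \<times> nat" where
  "leader r A = (THE w. w \<in> dvars A \<and> (\<forall>w'\<in>dvars A. (w', w) \<in> r))"

definition separant ::
  "('v \<times> nat) rel \<Rightarrow> ('v, 'a::comm_semiring_1) dpoly \<Rightarrow> ('v, 'a) dpoly" where
  "separant r A = partial_deriv (leader r A) A"

definition sat :: "('v \<times> nat) rel \<Rightarrow> ('v, 'a::differential_field) dpoly \<Rightarrow> ('v, 'a) dpoly set" where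
  "sat r A = {p. \<exists>m. separant r A ^ m * p \<in> diff_ideal_gen {A}}"


section \<open>Plane differential curves and their parametrizations\<close>

datatype indet = X | Y

text \<open>
  The irreducible curve \<open>(C, A)\<close> is determined by \<open>A\<close>, so properties of the curve are stated for \<open>A\<close>.
  Points of the affine plane over \<open>'e\<close> are functions of type \<open>indet \<Rightarrow> 'e\<close>.
\<close>

definition irreducible_curve :: "(indet, 'f::differential_field) dpoly \<Rightarrow> bool" where
  "irreducible_curve A \<longleftrightarrow> A \<notin> range dconst \<and> irreducible A"

definition linear_curve :: "(indet, 'f::differential_field) dpoly \<Rightarrow> bool" where
  "linear_curve A \<longleftrightarrow> irreducible_curve A \<and> total_degree A = 1"

definition rational_parametrization ::
  "('f::differential_field \<Rightarrow> 'e::differential_field) \<Rightarrow> 'e \<Rightarrow> (indet \<times> nat) rel \<Rightarrow>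
   (indet, 'f) dpoly \<Rightarrow> (indet \<Rightarrow> 'e) \<Rightarrow> bool" where
  "rational_parametrization \<iota> u r A P \<longleftrightarrow>
     range P \<subseteq> adjoin \<iota> {u} \<and> vanishing_ideal \<iota> P = sat r A"

definition unirational ::
  "('f::differential_field \<Rightarrow> 'e::differential_field) \<Rightarrow> 'e \<Rightarrow> (indet \<times> nat) rel \<Rightarrow>
   (indet, 'f) dpoly \<Rightarrow> bool" where
  "unirational \<iota> u r A \<longleftrightarrow> irreducible_curve A \<and> (\<exists>P. rational_parametrization \<iota> u r A P)"

definition proper ::
  "('f::differential_field \<Rightarrow> 'e::differential_field) \<Rightarrow> 'e \<Rightarrow> (indet \<Rightarrow> 'e) \<Rightarrow> bool" where
  "proper \<iota> u P \<longleftrightarrow> adjoin \<iota> (range P) = adjoin \<iota> {u}"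

definition linear_polynomial_point ::
  "('f::differential_field \<Rightarrow> 'e::differential_field) \<Rightarrow> 'e \<Rightarrow> (indet \<Rightarrow> 'e) \<Rightarrow> bool" where
  "linear_polynomial_point \<iota> u P \<longleftrightarrow>
     (\<forall>v. \<exists>p :: (unit, 'f) dpoly. total_degree p \<le> 1 \<and> P v = dpoly_eval \<iota> (\<lambda>_. u) p)"


section \<open>Linear differential operators\<close>

text \<open>
  The operator \<open>\<Sum>i. c\<^sub>i \<delta>\<^sup>i\<close> is represented by the polynomial with coefficients \<open>c\<^sub>i\<close>, which supplies
  addition, degree, leading coefficient and the unit \<open>1\<close>; the commutative product of
  \<open>'f poly\<close> is not used. Multiplication is determined by \<open>\<delta> c = c \<delta> + der c\<close>, so that left
  multiplication by \<open>\<delta>\<close> sends \<open>\<Sum>j. b\<^sub>j \<delta>\<^sup>j\<close> to \<open>\<Sum>j. (der b\<^sub>j \<delta>\<^sup>j + b\<^sub>j \<delta>\<^sup>j\<^sup>+\<^sup>1)\<close>.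
\<close>

definition delta_times :: "'f::differential_field poly \<Rightarrow> 'f poly" where
  "delta_times q = map_poly der q + pCons 0 q"

definition op_mult :: "'f::differential_field poly \<Rightarrow> 'f poly \<Rightarrow> 'f poly" (infixl "\<star>" 70) where
  "p \<star> q = (\<Sum>i\<le>degree p. smult (coeff p i) ((delta_times ^^ i) q))"

definition left_divisor :: "'f::differential_field poly \<Rightarrow> 'f poly \<Rightarrow> bool" where
  "left_divisor D L \<longleftrightarrow> (\<exists>Q. L = D \<star> Q)"

definition monic_common_left_divisor ::
  "'f::differential_field poly \<Rightarrow> 'f poly \<Rightarrow> 'f poly \<Rightarrow> bool" where
  "monic_common_left_divisor D L1 L2 \<longleftrightarrow>
     lead_coeff D = 1 \<and> left_divisor D L1 \<and> left_divisor D L2"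

text \<open>Well defined unless \<open>L1 = L2 = 0\<close>.\<close>

definition gcld :: "'f::differential_field poly \<Rightarrow> 'f poly \<Rightarrow> 'f poly" where
  "gcld L1 L2 =
     (THE D. monic_common_left_divisor D L1 L2 \<and>
        (\<forall>D'. monic_common_left_divisor D' L1 L2 \<longrightarrow> degree D' \<le> degree D))"

definition op_apply :: "'f::differential_field poly \<Rightarrow> 'v \<Rightarrow> ('v, 'f) dpoly" where
  "op_apply L v = (\<Sum>i\<le>degree L. dconst (coeff L i) * dvar (v, i))"

end

theory Submission
  imports Defs "HOL-Library.Product_Lexorder"
begin

text \<open>
  Everything rests on Euclid's algorithm in \<open>F[\<delta>]\<close>. Dividing with remainder so that quotients
  stand on the right, one finds an invertible \<open>2 \<times> 2\<close> matrix \<open>W\<close> of operators, with rows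
  \<open>(U, M1)\<close> and \<open>(V, M2)\<close>, that turns the row \<open>(L1, L2)\<close> into \<open>(D, 0)\<close> with \<open>D\<close> the monic greatest
  common left divisor (\<open>gcld_unimodular_reduction\<close>). Write \<open>(E1, E2)\<close> and \<open>(N1, N2)\<close> for the rows
  of the inverse of \<open>W\<close>; then \<open>L1 = D E1\<close> and \<open>L2 = D E2\<close>. The quantities \<open>z = E1(x) + E2(y)\<close> and
  \<open>t = N1(x) + N2(y)\<close> are new differential coordinates on the plane, in which the curve is
  \<open>D(z) + a = 0\<close>. The separant of a linear differential polynomial \<open>F\<close> is a nonzero constant, so
  \<open>sat(F)\<close> is simply \<open>[F]\<close>.

  If \<open>D = 1\<close>, the curve is \<open>z = - a\<close> with \<open>t\<close> free. Setting \<open>t = u\<close> gives the point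
  \<open>P = (M1(u) - U(a), M2(u) - V(a))\<close>, which is polynomial of degree at most 1 in \<open>u\<close> and proper since
  \<open>u = N1(P1) + N2(P2)\<close>. It is generic: expressing \<open>x, y\<close> by \<open>t\<close> through the parametrization, and
  then \<open>t\<close> by \<open>x, y\<close> again, changes a differential polynomial only by an element of \<open>[F]\<close>, and
  the intermediate polynomial in \<open>t\<close> is zero if the original one vanishes at \<open>P\<close>, because \<open>u\<close> is
  differentially transcendental (\<open>proper_parametrization\<close>).

  If \<open>D\<close> has positive degree and \<open>P\<close> were a generic point with coordinates in \<open>F\<langle>u\<rangle>\<close>, then
  \<open>w = E1(P1) + E2(P2)\<close> would satisfy \<open>D(w) + a = 0\<close>. A solution of such an equation in \<open>F\<langle>u\<rangle>\<close>
  is an element \<open>b\<close> of the base field (\<open>linear_ode_solution_in_base\<close>), for each differentiation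
  of an element outside the base field raises its order in \<open>u\<close>. Hence \<open>E1(x) + E2(y) - b\<close> vanishes at \<open>P\<close>
  and so lies in \<open>[F]\<close>. It does not: in a suitable differential ring the equation
  \<open>D(z) + a = 0\<close> has solutions other than \<open>z = b\<close> (\<open>factor_notin_diff_ideal\<close>).

  The assertion on arbitrary unirational linear curves follows, because a differential polynomial of
  total degree 1 has the form \<open>L1(x) + L2(y) + a\<close>, and both implications apply to it.
\<close>

section \<open>Evaluation homomorphisms\<close>

lemma poly_mapping_eq_sum_single:
  "(\<Sum>m\<in>Poly_Mapping.keys p. Poly_Mapping.single m (Poly_Mapping.lookup p m)) = p"
proof (rule poly_mapping_eqI)
  fix k
  show "Poly_Mapping.lookup (\<Sum>m\<in>Poly_Mapping.keys p. Poly_Mapping.single m (Poly_Mapping.lookup p m)) k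
      = Poly_Mapping.lookup p k"
    by (auto simp: lookup_sum lookup_single when_def sum.delta in_keys_iff)
qed

lemma dconst_simps [simp]:
  "dconst 0 = 0" "dconst 1 = (1 :: ('v, 'a::comm_ring_1) dpoly)"
  "dconst (a + b) = (dconst a + dconst b :: ('v, 'a) dpoly)"
  "dconst (a * b) = (dconst a * dconst b :: ('v, 'a) dpoly)"
  "dconst (- a) = (- dconst a :: ('v, 'a) dpoly)"
  by (simp_all add: dconst_def single_add mult_single single_uminus)

lemma dvar_power: "dvar w ^ n = (Poly_Mapping.single (Poly_Mapping.single w n) 1 :: ('v, 'a::comm_ring_1) dpoly)"
proof (induction n)
  case (Suc n)
  have "Poly_Mapping.single w (Suc n) = Poly_Mapping.single w 1 + Poly_Mapping.single w n"
    by (metis plus_1_eq_Suc single_add)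
  then show ?case using Suc by (simp add: mult_single dvar_def)
qed simp

lemma single_eq_prod_dvar:
  "Poly_Mapping.single m c = (dconst c * (\<Prod>w\<in>Poly_Mapping.keys m. dvar w ^ Poly_Mapping.lookup m w)
     :: ('v, 'a::comm_ring_1) dpoly)"
proof -
  have sum_exponents: "Poly_Mapping.single (\<Sum>w\<in>S. f w) (1::'a) = (\<Prod>w\<in>S. Poly_Mapping.single (f w) 1)"
    if "finite S" for S and f :: "_ \<Rightarrow> ('v \<times> nat) \<Rightarrow>\<^sub>0 nat"
    using that
  proof (induction S)
    case (insert x S)
    then show ?case using mult_single[of "f x" "1::'a" "sum f S" 1] by simp
  qed simp
  have "Poly_Mapping.single m (1::'a) =
      Poly_Mapping.single (\<Sum>w\<in>Poly_Mapping.keys m. Poly_Mapping.single w (Poly_Mapping.lookup m w)) 1"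
    by (simp only: poly_mapping_eq_sum_single)
  also have "\<dots> = (\<Prod>w\<in>Poly_Mapping.keys m. dvar w ^ Poly_Mapping.lookup m w)"
    by (subst sum_exponents) (simp_all add: dvar_power)
  finally have "Poly_Mapping.single m (1::'a) = \<dots>" .
  moreover have "Poly_Mapping.single m c = dconst c * Poly_Mapping.single m 1"
    by (simp add: dconst_def mult_single)
  ultimately show ?thesis by simp
qed

text \<open>
  A differential polynomial ring is generated by constants and derivatives of the indeterminates.
  Identities between ring homomorphisms and derivations can therefore be checked on these generators,
  without looking at monomials again.
\<close>
lemma dpoly_induct [case_names dconst dvar add mult]:
  fixes p :: "('v, 'a::comm_ring_1) dpoly"
  assumes "\<And>c. P (dconst c)" and "\<And>w. P (dvar w)"
    and "\<And>p q. P p \<Longrightarrow> P q \<Longrightarrow> P (p + q)" and "\<And>p q. P p \<Longrightarrow> P q \<Longrightarrow> P (p * q)"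
  shows "P p"
proof -
  have zero: "P 0" and one: "P 1" using assms(1)[of 0] assms(1)[of 1] by simp_all
  have power: "P (q ^ n)" if "P q" for q n
    by (induction n) (use that one assms(4) in auto)
  have prod: "P (prod f S)" if "finite S" "\<And>w. P (f w)"
    for S and f :: "('v \<times> nat) \<Rightarrow> ('v, 'a) dpoly"
    using that by (induction S) (use one assms(4) in auto)
  have sum: "P (sum f S)" if "finite S" "\<And>m. P (f m)"
    for S and f :: "(('v \<times> nat) \<Rightarrow>\<^sub>0 nat) \<Rightarrow> ('v, 'a) dpoly"
    using that by (induction S) (use zero assms(3) in auto)
  have "P (Poly_Mapping.single m c)" for m c
    unfolding single_eq_prod_dvar by (intro assms(4) assms(1) prod power assms(2)) auto
  then have "P (\<Sum>m\<in>Poly_Mapping.keys p. Poly_Mapping.single m (Poly_Mapping.lookup p m))"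
    by (intro sum) auto
  then show ?thesis by (simp only: poly_mapping_eq_sum_single)
qed

text \<open>
  Evaluation leaves the coefficient map \<open>h\<close> and the target ring arbitrary, because it serves for points
  in a field, for substitution of differential polynomials, and for maps into univariate polynomial
  rings.
\<close>
definition monom_eval :: "('k \<Rightarrow> 'r::comm_ring_1) \<Rightarrow> ('k \<Rightarrow>\<^sub>0 nat) \<Rightarrow> 'r" where
  "monom_eval g m = (\<Prod>w\<in>Poly_Mapping.keys m. g w ^ Poly_Mapping.lookup m w)"

definition peval :: "('a::comm_ring_1 \<Rightarrow> 'r::comm_ring_1) \<Rightarrow> ('v \<times> nat \<Rightarrow> 'r) \<Rightarrow> ('v, 'a) dpoly \<Rightarrow> 'r" where
  "peval h g p = (\<Sum>m\<in>Poly_Mapping.keys p. h (Poly_Mapping.lookup p m) * monom_eval g m)"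

lemma monom_eval_superset:
  assumes "finite S" "Poly_Mapping.keys m \<subseteq> S"
  shows "monom_eval g m = (\<Prod>w\<in>S. g w ^ Poly_Mapping.lookup m w)"
  unfolding monom_eval_def using assms by (intro prod.mono_neutral_left) (auto simp: in_keys_iff)

lemma monom_eval_add: "monom_eval g (m + n) = monom_eval g m * monom_eval g n"
proof -
  let ?S = "Poly_Mapping.keys m \<union> Poly_Mapping.keys n"
  have "monom_eval g (m + n) = (\<Prod>w\<in>?S. g w ^ Poly_Mapping.lookup (m + n) w)"
    using keys_add[of m n] by (intro monom_eval_superset) auto
  also have "\<dots> = (\<Prod>w\<in>?S. g w ^ Poly_Mapping.lookup m w) * (\<Prod>w\<in>?S. g w ^ Poly_Mapping.lookup n w)"
    by (simp add: lookup_add power_add prod.distrib)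
  also have "\<dots> = monom_eval g m * monom_eval g n"
    by (simp add: monom_eval_superset[of ?S])
  finally show ?thesis .
qed

locale comm_ring_map =
  fixes h :: "'a::comm_ring_1 \<Rightarrow> 'r::comm_ring_1"
  assumes h_one [simp]: "h 1 = 1"
    and h_add [simp]: "h (a + b) = h a + h b"
    and h_mult [simp]: "h (a * b) = h a * h b"
begin

lemma h_zero [simp]: "h 0 = 0"
  using h_add[of 0 0] by simp

lemma h_minus [simp]: "h (- a) = - h a"
  using h_add[of a "- a"] by (simp add: eq_neg_iff_add_eq_0 add.commute)

lemma h_diff [simp]: "h (a - b) = h a - h b"
  using h_add[of a "- b"] by simp

lemma h_sum: "h (sum f S) = (\<Sum>x\<in>S. h (f x))"
  by (induction S rule: infinite_finite_induct) auto

lemma h_power [simp]: "h (a ^ n) = h a ^ n"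
  by (induction n) auto

lemma peval_superset:
  assumes "finite S" "Poly_Mapping.keys p \<subseteq> S"
  shows "peval h g p = (\<Sum>m\<in>S. h (Poly_Mapping.lookup p m) * monom_eval g m)"
  unfolding peval_def using assms by (intro sum.mono_neutral_left) (auto simp: in_keys_iff)

lemma peval_single: "peval h g (Poly_Mapping.single m c) = h c * monom_eval g m"
  by (subst peval_superset[of "{m}"]) auto

lemma peval_dconst [simp]: "peval h g (dconst c) = h c"
  by (simp add: dconst_def peval_single monom_eval_def)

lemma peval_dvar [simp]: "peval h g (dvar w) = g w"
  by (simp add: dvar_def peval_single monom_eval_def)

lemma peval_zero [simp]: "peval h g 0 = 0"
  by (simp add: peval_def)

lemma peval_add [simp]: "peval h g (p + q) = peval h g p + peval h g q"
proof -
  let ?S = "Poly_Mapping.keys p \<union> Poly_Mapping.keys q"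
  have "peval h g (p + q) = (\<Sum>m\<in>?S. h (Poly_Mapping.lookup (p + q) m) * monom_eval g m)"
    using keys_add[of p q] by (intro peval_superset) auto
  also have "\<dots> = (\<Sum>m\<in>?S. h (Poly_Mapping.lookup p m) * monom_eval g m)
      + (\<Sum>m\<in>?S. h (Poly_Mapping.lookup q m) * monom_eval g m)"
    by (simp add: lookup_add distrib_right sum.distrib)
  also have "\<dots> = peval h g p + peval h g q"
    by (simp add: peval_superset[of ?S])
  finally show ?thesis .
qed

lemma peval_sum: "peval h g (sum f S) = (\<Sum>x\<in>S. peval h g (f x))"
  by (induction S rule: infinite_finite_induct) auto

lemma peval_mult [simp]: "peval h g (p * q) = peval h g p * peval h g q"
proof -
  let ?s = "\<lambda>p m. Poly_Mapping.single m (Poly_Mapping.lookup p m)"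
  have "peval h g (p * q)
      = peval h g ((\<Sum>m\<in>Poly_Mapping.keys p. ?s p m) * (\<Sum>n\<in>Poly_Mapping.keys q. ?s q n))"
    by (simp only: poly_mapping_eq_sum_single)
  also have "\<dots> = (\<Sum>m\<in>Poly_Mapping.keys p. \<Sum>n\<in>Poly_Mapping.keys q.
      (h (Poly_Mapping.lookup p m) * monom_eval g m) * (h (Poly_Mapping.lookup q n) * monom_eval g n))"
    by (simp add: sum_product peval_sum mult_single peval_single monom_eval_add mult_ac)
  also have "\<dots> = peval h g p * peval h g q"
    by (simp add: peval_def sum_product)
  finally show ?thesis .
qed

lemma comm_ring_map_peval: "comm_ring_map (peval h g)"
  by standard (use peval_dconst[of g 1] in \<open>simp_all del: peval_dconst\<close>)

end

lemma comm_ring_map_dconst: "comm_ring_map (dconst :: 'a::comm_ring_1 \<Rightarrow> ('v, 'a) dpoly)"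
  by standard simp_all

lemma ring_map_eqI:
  assumes "comm_ring_map \<Phi>" "comm_ring_map \<Psi>"
    and "\<And>c. \<Phi> (dconst c) = \<Psi> (dconst c)" and "\<And>w. \<Phi> (dvar w) = \<Psi> (dvar w)"
  shows "\<Phi> p = \<Psi> (p :: ('v, 'a::comm_ring_1) dpoly)"
  using assms(3,4)
  by (induction p rule: dpoly_induct)
    (simp_all add: comm_ring_map.h_add[OF assms(1)] comm_ring_map.h_add[OF assms(2)]
      comm_ring_map.h_mult[OF assms(1)] comm_ring_map.h_mult[OF assms(2)])

lemma comm_ring_map_comp: "comm_ring_map f \<Longrightarrow> comm_ring_map g \<Longrightarrow> comm_ring_map (\<lambda>x. g (f x))"
  by (simp add: comm_ring_map_def)

lemma peval_dconst_dvar: "peval dconst dvar p = (p :: ('v, 'a::comm_ring_1) dpoly)"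
proof (rule ring_map_eqI)
  interpret comm_ring_map "dconst :: 'a \<Rightarrow> ('v, 'a) dpoly" by (rule comm_ring_map_dconst)
  show "comm_ring_map (peval dconst (dvar :: _ \<Rightarrow> ('v, 'a) dpoly))" by (rule comm_ring_map_peval)
  show "comm_ring_map (\<lambda>p. p :: ('v, 'a) dpoly)" by standard simp_all
  show "peval dconst dvar (dconst c) = (dconst c :: ('v, 'a) dpoly)" for c by simp
  show "peval dconst dvar (dvar w) = (dvar w :: ('v, 'a) dpoly)" for w by simp
qed

section \<open>Derivations of differential polynomial rings\<close>

text \<open>
  The derivation that extends the one of the coefficient field and sends each variable \<open>w\<close> to a
  prescribed value \<open>s w\<close>. Besides the usual derivation, this covers quotients by a monic linear
  differential equation, where the highest derivative is replaced by a combination of the lower ones.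
\<close>
definition der_with ::
  "('v \<times> nat \<Rightarrow> ('v, 'a) dpoly) \<Rightarrow> ('v, 'a::differential_field) dpoly \<Rightarrow> ('v, 'a) dpoly" where
  "der_with s p =
     (\<Sum>m\<in>Poly_Mapping.keys p. Poly_Mapping.single m (der (Poly_Mapping.lookup p m))) +
     (\<Sum>w\<in>dvars p. partial_deriv w p * s w)"

lemma dpoly_der_eq: "dpoly_der = der_with (\<lambda>w. dvar (fst w, Suc (snd w)))"
  by (simp add: fun_eq_iff dpoly_der_def der_with_def)

lemma der_zero [simp]: "der (0::'a::differential_field) = 0"
  using der_add[of "0::'a" 0] by simp

lemma der_one [simp]: "der (1::'a::differential_field) = 0"
  using der_mult[of "1::'a" 1] by simp

lemma finite_dvars [simp]: "finite (dvars p)"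
  by (simp add: dvars_def)

lemma partial_deriv_superset:
  assumes "finite S" "Poly_Mapping.keys p \<subseteq> S"
  shows "partial_deriv w p = (\<Sum>m\<in>S. Poly_Mapping.single (m - Poly_Mapping.single w 1)
          (of_nat (Poly_Mapping.lookup m w) * Poly_Mapping.lookup p m))"
  unfolding partial_deriv_def using assms by (intro sum.mono_neutral_left) (auto simp: in_keys_iff)

lemma partial_deriv_add: "partial_deriv w (p + q) = partial_deriv w p + partial_deriv w q"
proof -
  let ?S = "Poly_Mapping.keys p \<union> Poly_Mapping.keys q"
  have "partial_deriv w (p + q) = (\<Sum>m\<in>?S. Poly_Mapping.single (m - Poly_Mapping.single w 1)
          (of_nat (Poly_Mapping.lookup m w) * Poly_Mapping.lookup (p + q) m))"
    using keys_add[of p q] by (intro partial_deriv_superset) auto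
  also have "\<dots> = partial_deriv w p + partial_deriv w q"
    by (simp add: partial_deriv_superset[of ?S] lookup_add distrib_left single_add sum.distrib)
  finally show ?thesis .
qed

lemma partial_deriv_single:
  "partial_deriv w (Poly_Mapping.single m c) =
     Poly_Mapping.single (m - Poly_Mapping.single w 1) (of_nat (Poly_Mapping.lookup m w) * c)"
  by (subst partial_deriv_superset[of "{m}"]) auto

lemma partial_deriv_eq_0: "w \<notin> dvars p \<Longrightarrow> partial_deriv w p = 0"
  unfolding partial_deriv_def by (intro sum.neutral) (auto simp: dvars_def in_keys_iff)

lemma der_with_superset:
  assumes "finite S" "dvars p \<subseteq> S" "finite M" "Poly_Mapping.keys p \<subseteq> M"
  shows "der_with s p = (\<Sum>m\<in>M. Poly_Mapping.single m (der (Poly_Mapping.lookup p m))) +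
     (\<Sum>w\<in>S. partial_deriv w p * s w)"
proof -
  have "(\<Sum>w\<in>dvars p. partial_deriv w p * s w) = (\<Sum>w\<in>S. partial_deriv w p * s w)"
    using assms by (intro sum.mono_neutral_left) (auto simp: partial_deriv_eq_0)
  moreover have "(\<Sum>m\<in>Poly_Mapping.keys p. Poly_Mapping.single m (der (Poly_Mapping.lookup p m)))
      = (\<Sum>m\<in>M. Poly_Mapping.single m (der (Poly_Mapping.lookup p m)))"
    using assms by (intro sum.mono_neutral_left) (auto simp: in_keys_iff)
  ultimately show ?thesis by (simp add: der_with_def)
qed

lemma dvars_add: "dvars (p + q) \<subseteq> dvars p \<union> dvars q"
  using keys_add[of p q] by (auto simp: dvars_def)

lemma der_with_add: "der_with s (p + q) = der_with s p + der_with s q"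
proof -
  let ?S = "dvars p \<union> dvars q" and ?M = "Poly_Mapping.keys p \<union> Poly_Mapping.keys q"
  have "der_with s (p + q) = (\<Sum>m\<in>?M. Poly_Mapping.single m (der (Poly_Mapping.lookup (p + q) m))) +
     (\<Sum>w\<in>?S. partial_deriv w (p + q) * s w)"
    using keys_add[of p q] dvars_add[of p q] by (intro der_with_superset) auto
  also have "\<dots> = der_with s p + der_with s q"
    by (simp add: der_with_superset[of ?S _ ?M] lookup_add der_add single_add sum.distrib
        partial_deriv_add distrib_right)
  finally show ?thesis .
qed

lemma der_with_zero [simp]: "der_with s 0 = 0"
  by (simp add: der_with_def dvars_def)

lemma der_with_sum: "der_with s (sum f S) = (\<Sum>x\<in>S. der_with s (f x))"
  by (induction S rule: infinite_finite_induct) (auto simp: der_with_add)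

lemma der_with_single:
  assumes "finite S" "Poly_Mapping.keys m \<subseteq> S"
  shows "der_with s (Poly_Mapping.single m c) = Poly_Mapping.single m (der c) +
     (\<Sum>w\<in>S. Poly_Mapping.single (m - Poly_Mapping.single w 1) (of_nat (Poly_Mapping.lookup m w) * c) * s w)"
  using assms by (subst der_with_superset[of S _ "{m}"]) (auto simp: dvars_def partial_deriv_single)

text \<open>
  Exponents are natural numbers and their subtraction truncates; if \<open>w\<close> does not occur in \<open>m\<close>,
  the coefficient vanishes on both sides.
\<close>
lemma single_diff_add_exponent:
  fixes c :: "'a::comm_ring_1"
  shows "Poly_Mapping.single (m + n - Poly_Mapping.single w 1) (of_nat (Poly_Mapping.lookup m w) * c)
   = Poly_Mapping.single (m - Poly_Mapping.single w 1 + n) (of_nat (Poly_Mapping.lookup m w) * c)"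
proof (cases "Poly_Mapping.lookup m w = 0")
  case False
  have "m + n - Poly_Mapping.single w 1 = m - Poly_Mapping.single w 1 + n"
    by (rule poly_mapping_eqI) (use False in \<open>auto simp: lookup_minus lookup_add lookup_single when_def\<close>)
  then show ?thesis by simp
qed simp

lemma der_with_mult_single:
  fixes c d :: "'a::differential_field"
  shows "der_with s (Poly_Mapping.single m c * Poly_Mapping.single n d) =
    der_with s (Poly_Mapping.single m c) * Poly_Mapping.single n d +
    Poly_Mapping.single m c * der_with s (Poly_Mapping.single n d)"
proof -
  let ?S = "Poly_Mapping.keys m \<union> Poly_Mapping.keys n"
  let ?e = "\<lambda>w. Poly_Mapping.single w (1::nat)"
  have "Poly_Mapping.single (m + n - ?e w) (of_nat (Poly_Mapping.lookup (m + n) w) * (c * d)) * s w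
     = Poly_Mapping.single (m - ?e w) (of_nat (Poly_Mapping.lookup m w) * c) * s w * Poly_Mapping.single n d
     + Poly_Mapping.single m c * (Poly_Mapping.single (n - ?e w) (of_nat (Poly_Mapping.lookup n w) * d) * s w)"
    for w
  proof -
    have "Poly_Mapping.single (m + n - ?e w) (of_nat (Poly_Mapping.lookup (m + n) w) * (c * d))
      = Poly_Mapping.single (m + n - ?e w) (of_nat (Poly_Mapping.lookup m w) * (c * d))
      + Poly_Mapping.single (n + m - ?e w) (of_nat (Poly_Mapping.lookup n w) * (c * d))"
      by (simp add: lookup_add distrib_right single_add add.commute)
    also have "\<dots> = Poly_Mapping.single (m - ?e w) (of_nat (Poly_Mapping.lookup m w) * c) * Poly_Mapping.single n d
      + Poly_Mapping.single m c * Poly_Mapping.single (n - ?e w) (of_nat (Poly_Mapping.lookup n w) * d)"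
      unfolding single_diff_add_exponent by (simp add: mult_single algebra_simps)
    finally show ?thesis by (simp add: algebra_simps)
  qed
  then show ?thesis
    using keys_add[of m n]
    by (simp add: mult_single der_with_single[of ?S] der_mult single_add distrib_right distrib_left
        sum.distrib sum_distrib_left sum_distrib_right)
qed

lemma der_with_mult: "der_with s (p * q) = der_with s p * q + p * der_with s q"
proof -
  let ?s = "\<lambda>p m. Poly_Mapping.single m (Poly_Mapping.lookup p m)"
  have "der_with s ((\<Sum>m\<in>A. ?s p m) * (\<Sum>n\<in>B. ?s q n)) =
      der_with s (\<Sum>m\<in>A. ?s p m) * (\<Sum>n\<in>B. ?s q n) + (\<Sum>m\<in>A. ?s p m) * der_with s (\<Sum>n\<in>B. ?s q n)"
    for A B
    by (simp add: sum_product der_with_sum der_with_mult_single sum.distrib)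
  from this[of "Poly_Mapping.keys p" "Poly_Mapping.keys q"] show ?thesis
    by (simp only: poly_mapping_eq_sum_single)
qed

lemma der_with_dconst [simp]: "der_with s (dconst c) = dconst (der c)"
  using der_with_single[of "{}" 0 s c] by (simp add: dconst_def)

lemma der_with_dvar [simp]: "der_with s (dvar w) = s w"
  using der_with_single[of "{w}" "Poly_Mapping.single w 1" s 1] by (simp add: dvar_def)

section \<open>Differential evaluation\<close>

text \<open>
  In \<open>deval h d \<eta>\<close> the derivatives of the indeterminate \<open>v\<close> go to the iterated \<open>d\<close>-derivatives of \<open>\<eta> v\<close>.
  The derivation \<open>d\<close> is an explicit argument, since the same ring is used with several derivations.
\<close>
definition deval ::
  "('a::comm_ring_1 \<Rightarrow> 'r::comm_ring_1) \<Rightarrow> ('r \<Rightarrow> 'r) \<Rightarrow> ('v \<Rightarrow> 'r) \<Rightarrow> ('v, 'a) dpoly \<Rightarrow> 'r" where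
  "deval h d \<eta> = peval h (\<lambda>w. (d ^^ snd w) (\<eta> (fst w)))"

definition act :: "('a::comm_ring_1 \<Rightarrow> 'r::comm_ring_1) \<Rightarrow> ('r \<Rightarrow> 'r) \<Rightarrow> 'a poly \<Rightarrow> 'r \<Rightarrow> 'r" where
  "act h d L x = (\<Sum>i\<le>degree L. h (coeff L i) * (d ^^ i) x)"

lemma dpoly_eval_eq_deval: "dpoly_eval \<iota> \<eta> = deval \<iota> der \<eta>"
  by (simp add: fun_eq_iff dpoly_eval_def deval_def peval_def monom_eval_def)

lemma op_apply_eq_act:
  "op_apply L v = (act dconst dpoly_der L (dvar (v, 0)) :: ('v, 'a::differential_field) dpoly)"
proof -
  have "(dpoly_der ^^ i) (dvar (v, 0)) = (dvar (v, i) :: ('v, 'a) dpoly)" for i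
    by (induction i) (simp_all add: dpoly_der_eq)
  then show ?thesis by (simp add: op_apply_def act_def)
qed

text \<open>
  A differential algebra over a differential field: \<open>h\<close> is the structure map, and \<open>d\<close> is a derivation
  compatible with it.
\<close>
locale diff_map = comm_ring_map h for h :: "'a::differential_field \<Rightarrow> 'r::comm_ring_1" +
  fixes d :: "'r \<Rightarrow> 'r"
  assumes d_add: "d (x + y) = d x + d y"
    and d_mult: "d (x * y) = d x * y + x * d y"
    and h_der: "h (der c) = d (h c)"
begin

lemma d_zero [simp]: "d 0 = 0"
  using d_add[of 0 0] by simp

lemma d_minus: "d (- x) = - d x"
  using d_add[of x "- x"] by (simp add: eq_neg_iff_add_eq_0 add.commute)

lemma iter_add: "(d ^^ i) (x + y) = (d ^^ i) x + (d ^^ i) y"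
  by (induction i) (simp_all add: d_add)

lemma iter_minus: "(d ^^ i) (- x) = - (d ^^ i) x"
  by (induction i) (simp_all add: d_minus)

lemma deval_dconst [simp]: "deval h d \<eta> (dconst c) = h c"
  by (simp add: deval_def)

lemma deval_dvar [simp]: "deval h d \<eta> (dvar w) = (d ^^ snd w) (\<eta> (fst w))"
  by (simp add: deval_def)

lemma comm_ring_map_deval: "comm_ring_map (deval h d \<eta>)"
  unfolding deval_def by (rule comm_ring_map_peval)

sublocale deval: comm_ring_map "deval h d \<eta>" for \<eta>
  by (rule comm_ring_map_deval)

lemma deval_dpoly_der: "deval h d \<eta> (dpoly_der p) = d (deval h d \<eta> p)"
  by (induction p rule: dpoly_induct)
    (simp_all add: dpoly_der_eq der_with_add der_with_mult h_der d_add d_mult)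

lemma act_degree_bound:
  assumes "degree L \<le> n"
  shows "act h d L x = (\<Sum>i\<le>n. h (coeff L i) * (d ^^ i) x)"
  unfolding act_def using assms by (intro sum.mono_neutral_left) (auto simp: coeff_eq_0)

lemma act_0 [simp]: "act h d 0 x = 0"
  by (simp add: act_def)

lemma act_1 [simp]: "act h d 1 x = x"
  by (simp add: act_def)

lemma act_pCons: "act h d (pCons c L) x = h c * x + act h d L (d x)"
proof -
  have "act h d (pCons c L) x = (\<Sum>i\<le>Suc (degree L). h (coeff (pCons c L) i) * (d ^^ i) x)"
    by (rule act_degree_bound) (rule degree_pCons_le)
  also have "\<dots> = h c * x + act h d L (d x)"
    by (simp add: sum.atMost_Suc_shift act_def funpow_swap1 del: sum.atMost_Suc)
  finally show ?thesis .
qed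

lemma act_add_left: "act h d (L + M) x = act h d L x + act h d M x"
proof -
  let ?n = "max (degree L) (degree M)"
  have "act h d (L + M) x = (\<Sum>i\<le>?n. h (coeff (L + M) i) * (d ^^ i) x)"
    by (rule act_degree_bound) (rule degree_add_le_max)
  also have "\<dots> = act h d L x + act h d M x"
    by (simp add: act_degree_bound[of _ ?n] distrib_right sum.distrib)
  finally show ?thesis .
qed

lemma act_smult: "act h d (smult c L) x = h c * act h d L x"
proof -
  have "act h d (smult c L) x = (\<Sum>i\<le>degree L. h (coeff (smult c L) i) * (d ^^ i) x)"
    by (rule act_degree_bound) (rule degree_smult_le)
  also have "\<dots> = h c * act h d L x"
    by (simp add: act_def sum_distrib_left mult.assoc)
  finally show ?thesis .
qed

lemma act_add_right: "act h d L (x + y) = act h d L x + act h d L y"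
  by (simp add: act_def iter_add distrib_left sum.distrib)

lemma act_minus_right: "act h d L (- x) = - act h d L x"
  by (simp add: act_def iter_minus sum_negf)

text \<open>
  Left multiplication by \<open>\<delta>\<close> is differentiation of the result, which is what the formula
  \<open>\<delta> c = c \<delta> + der c\<close> encodes.
\<close>
lemma act_delta_times: "act h d (delta_times L) x = d (act h d L x)"
proof (induction L arbitrary: x)
  case (pCons c L)
  have "delta_times (pCons c L) = pCons (der c) (delta_times L) + [:0, c:]"
    by (rule poly_eqI) (simp add: delta_times_def coeff_map_poly coeff_pCons split: nat.splits)
  then have "act h d (delta_times (pCons c L)) x
      = h (der c) * x + act h d (delta_times L) (d x) + h c * d x"
    by (simp add: act_add_left act_pCons del: add_pCons)
  then show ?case
    by (simp add: pCons.IH act_pCons h_der d_add d_mult algebra_simps)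
qed (simp add: delta_times_def)

lemma deval_act:
  "deval h d \<eta> (act dconst dpoly_der L p) = act h d L (deval h d \<eta> p)"
proof -
  have "deval h d \<eta> ((dpoly_der ^^ i) p) = (d ^^ i) (deval h d \<eta> p)" for i
    by (induction i) (simp_all add: deval_dpoly_der)
  then show ?thesis by (simp add: act_def deval.h_sum)
qed

lemma deval_op_apply: "deval h d \<eta> (op_apply L v) = act h d L (\<eta> v)"
  by (simp add: op_apply_eq_act deval_act)

end

lemma diff_map_der_with: "diff_map (dconst :: 'a::differential_field \<Rightarrow> ('v, 'a) dpoly) (der_with s)"
  by (intro diff_map.intro comm_ring_map_dconst diff_map_axioms.intro)
    (simp_all add: der_with_add der_with_mult)

lemma diff_map_dpoly_der: "diff_map (dconst :: 'a::differential_field \<Rightarrow> ('v, 'a) dpoly) dpoly_der"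
  unfolding dpoly_der_eq by (rule diff_map_der_with)

lemma diff_map_embedding: "diff_embedding \<iota> \<Longrightarrow> diff_map \<iota> der"
  by standard (simp_all add: diff_embedding_def der_add der_mult)

lemma embedding_eq_0:
  assumes "diff_embedding \<iota>" "\<iota> c = 0"
  shows "c = 0"
proof (rule ccontr)
  interpret diff_map \<iota> der using assms(1) by (rule diff_map_embedding)
  assume "c \<noteq> 0"
  then have "\<iota> (1 / c) * \<iota> c = 1" by (simp flip: h_mult)
  then show False using assms(2) by simp
qed

lemma diff_map_comp:
  assumes "diff_map h d" "diff_map h' d'" "comm_ring_map \<Phi>"
    and "\<And>c. \<Phi> (h c) = h' c" "\<And>x. \<Phi> (d x) = d' (\<Phi> x)"
  shows "\<Phi> (deval h d \<eta> p) = deval h' d' (\<lambda>v. \<Phi> (\<eta> v)) p"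
proof (rule ring_map_eqI)
  interpret A: diff_map h d by fact
  interpret B: diff_map h' d' by fact
  have iter: "\<Phi> ((d ^^ i) x) = (d' ^^ i) (\<Phi> x)" for i x
    by (induction i) (simp_all add: assms)
  show "comm_ring_map (\<lambda>p. \<Phi> (deval h d \<eta> p))"
    by (rule comm_ring_map_comp[OF A.comm_ring_map_deval assms(3)])
  show "comm_ring_map (deval h' d' (\<lambda>v. \<Phi> (\<eta> v)))"
    by (rule B.comm_ring_map_deval)
  show "\<Phi> (deval h d \<eta> (dconst c)) = deval h' d' (\<lambda>v. \<Phi> (\<eta> v)) (dconst c)" for c
    by (simp add: assms)
  show "\<Phi> (deval h d \<eta> (dvar w)) = deval h' d' (\<lambda>v. \<Phi> (\<eta> v)) (dvar w)" for w
    by (simp add: iter)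
qed

lemma deval_deval:
  assumes "diff_map h d"
  shows "deval h d \<eta> (deval dconst dpoly_der \<theta> p) = deval h d (\<lambda>v. deval h d \<eta> (\<theta> v)) p"
  by (rule diff_map_comp[OF diff_map_dpoly_der assms])
    (simp_all add: diff_map.comm_ring_map_deval[OF assms] diff_map.deval_dconst[OF assms]
      diff_map.deval_dpoly_der[OF assms])

section \<open>The ring of linear differential operators\<close>

lemma delta_times_0 [simp]: "delta_times 0 = 0"
  by (simp add: delta_times_def)

lemma coeff_delta_times:
  "coeff (delta_times q) n = der (coeff q n) + (case n of 0 \<Rightarrow> 0 | Suc k \<Rightarrow> coeff q k)"
  by (simp add: delta_times_def coeff_map_poly coeff_pCons)

lemma delta_times_add: "delta_times (p + q) = delta_times p + delta_times q"
  by (rule poly_eqI) (simp add: coeff_delta_times der_add split: nat.splits)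

lemma delta_times_smult: "delta_times (smult c q) = smult (der c) q + smult c (delta_times q)"
  by (rule poly_eqI) (simp add: coeff_delta_times der_mult algebra_simps split: nat.splits)

lemma op_mult_degree_bound:
  assumes "degree p \<le> n"
  shows "p \<star> q = (\<Sum>i\<le>n. smult (coeff p i) ((delta_times ^^ i) q))"
  unfolding op_mult_def using assms by (intro sum.mono_neutral_left) (auto simp: coeff_eq_0)

lemma op_mult_0_left [simp]: "0 \<star> q = 0"
  by (simp add: op_mult_def)

lemma op_mult_pCons: "pCons c p \<star> q = smult c q + p \<star> delta_times q"
proof -
  have "pCons c p \<star> q = (\<Sum>i\<le>Suc (degree p). smult (coeff (pCons c p) i) ((delta_times ^^ i) q))"
    by (rule op_mult_degree_bound) (rule degree_pCons_le)
  also have "\<dots> = smult c q + p \<star> delta_times q"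
    by (simp add: sum.atMost_Suc_shift op_mult_def funpow_swap1 del: sum.atMost_Suc)
  finally show ?thesis .
qed

lemma op_mult_0_right [simp]: "p \<star> 0 = 0"
  by (induction p) (simp_all add: op_mult_pCons)

lemma op_mult_const_left [simp]: "[:c:] \<star> q = smult c q"
  by (simp add: op_mult_pCons)

lemma op_mult_1_left [simp]: "1 \<star> q = q"
  by (simp add: one_pCons)

lemma op_mult_add_left: "(p + q) \<star> r = p \<star> r + q \<star> r"
proof -
  let ?n = "max (degree p) (degree q)"
  have "(p + q) \<star> r = (\<Sum>i\<le>?n. smult (coeff (p + q) i) ((delta_times ^^ i) r))"
    by (rule op_mult_degree_bound) (rule degree_add_le_max)
  also have "\<dots> = p \<star> r + q \<star> r"
    by (simp add: op_mult_degree_bound[of _ ?n] smult_add_left sum.distrib)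
  finally show ?thesis .
qed

lemma op_mult_add_right: "p \<star> (q + r) = p \<star> q + p \<star> r"
  by (induction p arbitrary: q r) (simp_all add: op_mult_pCons delta_times_add smult_add_right)

lemma op_mult_minus_left: "(- p) \<star> q = - (p \<star> q)"
  using op_mult_add_left[of p "- p" q] by (simp add: eq_neg_iff_add_eq_0 add.commute)

lemma op_mult_minus_right: "p \<star> (- q) = - (p \<star> q)"
  using op_mult_add_right[of p q "- q"] by (simp add: eq_neg_iff_add_eq_0 add.commute)

lemma op_mult_diff_left: "(p - q) \<star> r = p \<star> r - q \<star> r"
  using op_mult_add_left[of p "- q" r] by (simp add: op_mult_minus_left)

lemma op_mult_diff_right: "p \<star> (q - r) = p \<star> q - p \<star> r"
  using op_mult_add_right[of p q "- r"] by (simp add: op_mult_minus_right)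

lemma op_mult_smult_left: "smult c p \<star> q = smult c (p \<star> q)"
  by (induction p arbitrary: q) (simp_all add: op_mult_pCons smult_add_right)

lemma op_mult_1_right [simp]: "p \<star> 1 = p"
proof -
  have power: "(delta_times ^^ i) 1 = (monom 1 i :: 'a poly)" for i
    by (induction i) (auto intro!: poly_eqI simp: coeff_delta_times split: nat.splits)
  show ?thesis
    unfolding op_mult_def power by (simp add: smult_monom poly_as_sum_of_monoms)
qed

lemma delta_times_pCons: "delta_times (pCons c p) = pCons (der c) (delta_times p) + [:0, c:]"
  by (rule poly_eqI) (simp add: coeff_delta_times coeff_pCons split: nat.splits)

text \<open>
  Associativity for the factor \<open>\<delta>\<close>; the general case follows by induction on the left factor.
\<close>
lemma delta_times_op_mult: "delta_times (p \<star> q) = delta_times p \<star> q"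
proof (induction p arbitrary: q)
  case (pCons c p)
  have "delta_times (pCons c p) \<star> q = smult (der c) q + delta_times p \<star> delta_times q + smult c (delta_times q)"
    unfolding delta_times_pCons by (simp add: op_mult_add_left op_mult_pCons del: add_pCons)
  then show ?case by (simp add: op_mult_pCons delta_times_add delta_times_smult pCons.IH)
qed simp

lemma op_mult_assoc: "(p \<star> q) \<star> r = p \<star> (q \<star> r)"
  by (induction p arbitrary: q)
    (simp_all add: op_mult_pCons op_mult_add_left op_mult_smult_left delta_times_op_mult)

lemma (in diff_map) act_op_mult: "act h d (p \<star> q) x = act h d p (act h d q x)"
  by (induction p arbitrary: q)
    (simp_all add: op_mult_pCons act_pCons act_add_left act_smult act_delta_times)

text \<open>
  Commuting \<open>\<delta>\<close> past a coefficient creates only terms of lower order, so leading terms multiply as in a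
  commutative polynomial ring. Degree bounds in place of degrees let the induction pass through zero
  coefficients.
\<close>
lemma coeff_op_mult_top:
  assumes "degree p \<le> m" "degree q \<le> n"
  shows "coeff (p \<star> q) (m + n) = coeff p m * coeff q n \<and> degree (p \<star> q) \<le> m + n"
  using assms
proof (induction p arbitrary: m n q)
  case (pCons c p)
  show ?case
  proof (cases "p = 0")
    case True
    show ?thesis
    proof (cases m)
      case 0
      then show ?thesis using pCons.prems True by simp
    next
      case (Suc k)
      then show ?thesis using pCons.prems True degree_smult_le[of c q] by (simp add: coeff_eq_0)
    qed
  next
    case False
    with pCons.prems obtain k where m: "m = Suc k" and k: "degree p \<le> k"
      by (cases m) auto
    have deg: "degree (delta_times q) \<le> Suc n"
      using pCons.prems(2) by (intro degree_le) (auto simp: coeff_delta_times coeff_eq_0 split: nat.splits)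
    have "coeff (delta_times q) (Suc n) = coeff q n"
      using pCons.prems(2) by (simp add: coeff_delta_times coeff_eq_0)
    moreover have "coeff q (Suc k + n) = 0"
      using pCons.prems(2) by (simp add: coeff_eq_0)
    moreover have "degree (smult c q) \<le> Suc (k + n)"
      using degree_smult_le[of c q] pCons.prems(2) by simp
    ultimately show ?thesis
      using pCons.IH[OF k deg] by (simp add: m op_mult_pCons degree_add_le)
  qed
qed simp

lemma lead_coeff_op_mult: "lead_coeff (p \<star> q) = lead_coeff p * lead_coeff q"
  and degree_op_mult: "p \<noteq> 0 \<Longrightarrow> q \<noteq> 0 \<Longrightarrow> degree (p \<star> q) = degree p + degree q"
proof -
  have top: "coeff (p \<star> q) (degree p + degree q) = lead_coeff p * lead_coeff q"
    and le: "degree (p \<star> q) \<le> degree p + degree q"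
    using coeff_op_mult_top[of p "degree p" q "degree q"] by auto
  show deg: "degree (p \<star> q) = degree p + degree q" if "p \<noteq> 0" "q \<noteq> 0"
    using le le_degree[of "p \<star> q" "degree p + degree q"] that top by simp
  show "lead_coeff (p \<star> q) = lead_coeff p * lead_coeff q"
    using deg top by (cases "p = 0 \<or> q = 0") auto
qed

text \<open>
  Subtracting \<open>B \<star> monom c k\<close> with \<open>c\<close> the quotient of the leading coefficients cancels the leading
  term of \<open>A\<close>. The quotient is on the right of \<open>B\<close>, as needed for common left divisors.
\<close>
lemma op_division:
  assumes "B \<noteq> 0"
  shows "\<exists>Q R. A = B \<star> Q + R \<and> (R = 0 \<or> degree R < degree B)"
proof (induction "degree A" arbitrary: A rule: less_induct)
  case less
  show ?case
  proof (cases "A = 0 \<or> degree A < degree B")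
    case True
    then have "A = B \<star> 0 + A \<and> (A = 0 \<or> degree A < degree B)" by simp
    then show ?thesis by blast
  next
    case False
    let ?T = "monom (lead_coeff A / lead_coeff B) (degree A - degree B)"
    let ?A' = "A - B \<star> ?T"
    have "lead_coeff A / lead_coeff B \<noteq> 0" using False assms by simp
    then have T: "?T \<noteq> 0" "degree ?T = degree A - degree B"
      by (simp_all only: monom_eq_0_iff degree_monom_eq not_False_eq_True simp_thms)
    have deg: "degree (B \<star> ?T) = degree A"
      using degree_op_mult[OF assms T(1)] False unfolding T(2) by simp
    have lead: "lead_coeff (B \<star> ?T) = lead_coeff A"
      unfolding lead_coeff_op_mult T(2) using assms by simp
    show ?thesis
    proof (cases "?A' = 0")
      case True
      then have "A = B \<star> ?T + 0 \<and> ((0::'a poly) = 0 \<or> degree (0::'a poly) < degree B)" by simp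
      then show ?thesis by blast
    next
      case nz: False
      have "coeff ?A' (degree A) = 0" using lead deg by simp
      moreover have "degree ?A' \<le> degree A" using deg by (simp add: degree_diff_le)
      ultimately have smaller: "degree ?A' < degree A"
        using nz by (metis le_neq_implies_less leading_coeff_0_iff)
      obtain Q R where "?A' = B \<star> Q + R" "R = 0 \<or> degree R < degree B"
        using less.hyps[OF smaller] by blast
      then have "A = B \<star> (?T + Q) + R" by (simp add: op_mult_add_right algebra_simps)
      with \<open>R = 0 \<or> degree R < degree B\<close> show ?thesis by blast
    qed
  qed
qed

section \<open>Greatest common left divisors and unimodular reduction\<close>

text \<open>
  The matrix with rows \<open>(U, M1)\<close>, \<open>(V, M2)\<close> and the matrix with rows \<open>(E1, E2)\<close>, \<open>(N1, N2)\<close> are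
  inverse to each other, and \<open>(L1, L2)\<close> is the product of \<open>(D, 0)\<close> with the latter. Over a
  noncommutative ring both products of the two matrices have to be recorded.
\<close>
definition unimodular_reduction where
  "unimodular_reduction L1 L2 D U V M1 M2 E1 E2 N1 N2 \<longleftrightarrow>
     D \<star> E1 = L1 \<and> D \<star> E2 = L2 \<and>
     U \<star> E1 + M1 \<star> N1 = 1 \<and> U \<star> E2 + M1 \<star> N2 = 0 \<and>
     V \<star> E1 + M2 \<star> N1 = 0 \<and> V \<star> E2 + M2 \<star> N2 = 1 \<and>
     E1 \<star> U + E2 \<star> V = 1 \<and> E1 \<star> M1 + E2 \<star> M2 = 0 \<and>
     N1 \<star> U + N2 \<star> V = 0 \<and> N1 \<star> M1 + N2 \<star> M2 = 1"

lemma unimodular_reduction_bezout: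
  assumes "unimodular_reduction L1 L2 D U V M1 M2 E1 E2 N1 N2"
  shows "L1 \<star> U + L2 \<star> V = D"
proof -
  have "L1 \<star> U + L2 \<star> V = D \<star> (E1 \<star> U + E2 \<star> V)"
    using assms unfolding unimodular_reduction_def by (metis op_mult_add_right op_mult_assoc)
  then show ?thesis using assms by (simp add: unimodular_reduction_def)
qed

text \<open>
  One step of Euclid's algorithm: \<open>(L2, R)\<close> is \<open>(L1, L2)\<close> times the elementary matrix with rows \<open>(0, 1)\<close>
  and \<open>(1, -Q)\<close>, whose inverse has rows \<open>(Q, 1)\<close> and \<open>(1, 0)\<close>. The matrix of the reduction is
  multiplied by the former from the left, and its inverse by the latter from the right.
\<close>
lemma unimodular_reduction_step:
  assumes "unimodular_reduction L2 R D U V M1 M2 E1 E2 N1 N2" and L1: "L1 = L2 \<star> Q + R"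
  shows "unimodular_reduction L1 L2 D V (U - Q \<star> V) M2 (M1 - Q \<star> M2)
           (E1 \<star> Q + E2) E1 (N1 \<star> Q + N2) N1"
proof -
  note simps = op_mult_add_left op_mult_add_right op_mult_diff_left op_mult_diff_right
    op_mult_assoc
  have D: "D \<star> E1 = L2" "D \<star> E2 = R"
    and i: "U \<star> E1 + M1 \<star> N1 = 1" "U \<star> E2 + M1 \<star> N2 = 0"
      "V \<star> E1 + M2 \<star> N1 = 0" "V \<star> E2 + M2 \<star> N2 = 1"
    and j: "E1 \<star> U + E2 \<star> V = 1" "E1 \<star> M1 + E2 \<star> M2 = 0"
      "N1 \<star> U + N2 \<star> V = 0" "N1 \<star> M1 + N2 \<star> M2 = 1"
    using assms by (simp_all add: unimodular_reduction_def)
  have VQ: "V \<star> (E1 \<star> Q) + M2 \<star> (N1 \<star> Q) = 0"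
    using arg_cong[OF i(3), of "\<lambda>x. x \<star> Q"] by (simp add: simps)
  have UQ: "U \<star> (E1 \<star> Q) + M1 \<star> (N1 \<star> Q) = Q"
    using arg_cong[OF i(1), of "\<lambda>x. x \<star> Q"] by (simp add: simps)
  have QV: "Q \<star> (V \<star> E1) + Q \<star> (M2 \<star> N1) = 0"
    using arg_cong[OF i(3), of "\<lambda>x. Q \<star> x"] by (simp add: simps)
  have QV2: "Q \<star> (V \<star> E2) + Q \<star> (M2 \<star> N2) = Q"
    using arg_cong[OF i(4), of "\<lambda>x. Q \<star> x"] by (simp add: simps)
  have QVQ: "Q \<star> (V \<star> (E1 \<star> Q)) + Q \<star> (M2 \<star> (N1 \<star> Q)) = 0"
    using arg_cong[OF VQ, of "\<lambda>x. Q \<star> x"] by (simp add: simps)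
  show ?thesis
    unfolding unimodular_reduction_def
  proof (intro conjI)
    show "D \<star> (E1 \<star> Q + E2) = L1"
      using D L1 by (simp add: op_mult_add_right flip: op_mult_assoc)
    show "V \<star> (E1 \<star> Q + E2) + M2 \<star> (N1 \<star> Q + N2) = 1"
    proof -
      have "V \<star> (E1 \<star> Q + E2) + M2 \<star> (N1 \<star> Q + N2)
        = (V \<star> (E1 \<star> Q) + M2 \<star> (N1 \<star> Q)) + (V \<star> E2 + M2 \<star> N2)"
        by (simp add: simps)
      then show ?thesis unfolding VQ i(4) by simp
    qed
    have "(U - Q \<star> V) \<star> (E1 \<star> Q + E2) + (M1 - Q \<star> M2) \<star> (N1 \<star> Q + N2)
      = (U \<star> (E1 \<star> Q) + M1 \<star> (N1 \<star> Q)) + (U \<star> E2 + M1 \<star> N2)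
        - (Q \<star> (V \<star> (E1 \<star> Q)) + Q \<star> (M2 \<star> (N1 \<star> Q)))
        - (Q \<star> (V \<star> E2) + Q \<star> (M2 \<star> N2))"
      by (simp add: simps)
    then show "(U - Q \<star> V) \<star> (E1 \<star> Q + E2) + (M1 - Q \<star> M2) \<star> (N1 \<star> Q + N2) = 0"
      unfolding UQ i(2) QVQ QV2 by simp
    have "(U - Q \<star> V) \<star> E1 + (M1 - Q \<star> M2) \<star> N1
      = (U \<star> E1 + M1 \<star> N1) - (Q \<star> (V \<star> E1) + Q \<star> (M2 \<star> N1))"
      by (simp add: simps)
    then show "(U - Q \<star> V) \<star> E1 + (M1 - Q \<star> M2) \<star> N1 = 1"
      unfolding i(1) QV by simp
    have "(E1 \<star> Q + E2) \<star> V + E1 \<star> (U - Q \<star> V) = E1 \<star> U + E2 \<star> V"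
      by (simp add: simps)
    then show "(E1 \<star> Q + E2) \<star> V + E1 \<star> (U - Q \<star> V) = 1" using j(1) by simp
    have "(E1 \<star> Q + E2) \<star> M2 + E1 \<star> (M1 - Q \<star> M2) = E1 \<star> M1 + E2 \<star> M2"
      by (simp add: simps)
    then show "(E1 \<star> Q + E2) \<star> M2 + E1 \<star> (M1 - Q \<star> M2) = 0" using j(2) by simp
    have "(N1 \<star> Q + N2) \<star> V + N1 \<star> (U - Q \<star> V) = N1 \<star> U + N2 \<star> V"
      by (simp add: simps)
    then show "(N1 \<star> Q + N2) \<star> V + N1 \<star> (U - Q \<star> V) = 0" using j(3) by simp
    have "(N1 \<star> Q + N2) \<star> M2 + N1 \<star> (M1 - Q \<star> M2) = N1 \<star> M1 + N2 \<star> M2"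
      by (simp add: simps)
    then show "(N1 \<star> Q + N2) \<star> M2 + N1 \<star> (M1 - Q \<star> M2) = 1" using j(4) by simp
  qed (use D i in simp_all)
qed

lemma unimodular_reduction_exists:
  "\<exists>D U V M1 M2 E1 E2 N1 N2. unimodular_reduction L1 L2 D U V M1 M2 E1 E2 N1 N2"
proof (induction "if L2 = 0 then 0 else Suc (degree L2)" arbitrary: L1 L2 rule: less_induct)
  case less
  show ?case
  proof (cases "L2 = 0")
    case True
    then have "unimodular_reduction L1 L2 L1 1 0 0 1 1 0 0 1"
      by (simp add: unimodular_reduction_def)
    then show ?thesis by blast
  next
    case False
    obtain Q R where QR: "L1 = L2 \<star> Q + R" "R = 0 \<or> degree R < degree L2"
      using op_division[OF False] by blast
    have "(if R = 0 then 0 else Suc (degree R)) < (if L2 = 0 then 0 else Suc (degree L2))"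
      using QR(2) False by auto
    from less.hyps[OF this, of L2] obtain D U V M1 M2 E1 E2 N1 N2
      where "unimodular_reduction L2 R D U V M1 M2 E1 E2 N1 N2" by blast
    from unimodular_reduction_step[OF this QR(1)] show ?thesis by blast
  qed
qed

text \<open>
  Euclid's algorithm gives \<open>D0\<close> up to a unit on the right, and \<open>D0 \<star> [:1 / c:]\<close> is monic. By the Bezout
  identity every common left divisor divides \<open>D\<close> on the left; so \<open>D\<close> has the highest degree, and a
  competitor of the same degree differs from \<open>D\<close> by a constant, which is 1 as both are monic.
\<close>
lemma gcld_unimodular_reduction:
  assumes nz: "L1 \<noteq> 0 \<or> L2 \<noteq> 0"
  shows "lead_coeff (gcld L1 L2) = 1 \<and>
    (\<exists>U V M1 M2 E1 E2 N1 N2. unimodular_reduction L1 L2 (gcld L1 L2) U V M1 M2 E1 E2 N1 N2)"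
proof -
  obtain D0 U0 V0 M1 M2 E10 E20 N1 N2
    where r0: "unimodular_reduction L1 L2 D0 U0 V0 M1 M2 E10 E20 N1 N2"
    using unimodular_reduction_exists by blast
  have D0: "D0 \<noteq> 0" using r0 nz by (auto simp: unimodular_reduction_def)
  define c where "c = lead_coeff D0"
  have c: "c \<noteq> 0" using D0 by (simp add: c_def)
  have cancel: "A \<star> [:1 / c:] \<star> smult c B = A \<star> B" for A B
    using c by (simp add: op_mult_assoc)
  define D where "D = D0 \<star> [:1 / c:]"
  define U V where "U = U0 \<star> [:1 / c:]" and "V = V0 \<star> [:1 / c:]"
  define E1 E2 where "E1 = smult c E10" and "E2 = smult c E20"
  have r: "unimodular_reduction L1 L2 D U V M1 M2 E1 E2 N1 N2"
    unfolding unimodular_reduction_def D_def U_def V_def E1_def E2_def cancel op_mult_smult_left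
  proof (intro conjI)
    have "smult c (E10 \<star> (U0 \<star> [:1 / c:])) + smult c (E20 \<star> (V0 \<star> [:1 / c:]))
      = smult c ((E10 \<star> U0 + E20 \<star> V0) \<star> [:1 / c:])"
      by (simp add: op_mult_add_left op_mult_assoc smult_add_right)
    then show "smult c (E10 \<star> (U0 \<star> [:1 / c:])) + smult c (E20 \<star> (V0 \<star> [:1 / c:])) = 1"
      using r0 c by (simp add: unimodular_reduction_def one_pCons)
    have "N1 \<star> (U0 \<star> [:1 / c:]) + N2 \<star> (V0 \<star> [:1 / c:]) = (N1 \<star> U0 + N2 \<star> V0) \<star> [:1 / c:]"
      by (simp add: op_mult_add_left op_mult_assoc)
    then show "N1 \<star> (U0 \<star> [:1 / c:]) + N2 \<star> (V0 \<star> [:1 / c:]) = 0"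
      using r0 by (simp add: unimodular_reduction_def)
    have "smult c (E10 \<star> M1) + smult c (E20 \<star> M2) = smult c (E10 \<star> M1 + E20 \<star> M2)"
      by (simp add: smult_add_right)
    then show "smult c (E10 \<star> M1) + smult c (E20 \<star> M2) = 0"
      using r0 by (simp add: unimodular_reduction_def)
  qed (use r0 in \<open>simp_all add: unimodular_reduction_def\<close>)
  have monic: "lead_coeff D = 1" using c by (simp add: D_def lead_coeff_op_mult c_def)
  then have D: "D \<noteq> 0" by auto
  have divides: "monic_common_left_divisor D L1 L2"
    using r monic by (auto simp: unimodular_reduction_def monic_common_left_divisor_def left_divisor_def)
  have factor: "\<exists>C. D = D' \<star> C" if D': "monic_common_left_divisor D' L1 L2" for D'
  proof -
    obtain A B where AB: "L1 = D' \<star> A" "L2 = D' \<star> B"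
      using D' by (auto simp: monic_common_left_divisor_def left_divisor_def)
    have "D = D' \<star> (A \<star> U + B \<star> V)"
      using unimodular_reduction_bezout[OF r] AB by (simp add: op_mult_add_right op_mult_assoc)
    then show ?thesis by blast
  qed
  have degree_factor: "degree D = degree D' + degree C"
    if "monic_common_left_divisor D' L1 L2" "D = D' \<star> C" for D' C
    using that D by (auto intro!: degree_op_mult)
  have "gcld L1 L2 = D"
    unfolding gcld_def
  proof (rule the_equality)
    show "monic_common_left_divisor D L1 L2 \<and>
      (\<forall>D'. monic_common_left_divisor D' L1 L2 \<longrightarrow> degree D' \<le> degree D)"
      using divides factor degree_factor by (metis le_add1)
  next
    fix D' assume D': "monic_common_left_divisor D' L1 L2 \<and>
      (\<forall>D''. monic_common_left_divisor D'' L1 L2 \<longrightarrow> degree D'' \<le> degree D')"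
    then obtain C where C: "D = D' \<star> C" using factor by blast
    have "degree C = 0" using degree_factor[OF conjunct1[OF D'] C] D' divides by fastforce
    moreover have "lead_coeff C = 1"
      using monic D' unfolding C lead_coeff_op_mult by (simp add: monic_common_left_divisor_def)
    ultimately have "C = 1" by (metis degree_eq_zeroE coeff_pCons_0 one_pCons)
    then show "D' = D" using C by simp
  qed
  then show ?thesis using r monic by blast
qed

section \<open>Differential ideals\<close>

lemma diff_ideal_diff_ideal_gen: "diff_ideal (diff_ideal_gen S)"
  by (simp add: diff_ideal_gen_def diff_ideal_def)

lemma subset_diff_ideal_gen: "S \<subseteq> diff_ideal_gen S"
  by (auto simp: diff_ideal_gen_def)

lemma diff_ideal_gen_subset: "diff_ideal I \<Longrightarrow> S \<subseteq> I \<Longrightarrow> diff_ideal_gen S \<subseteq> I"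
  by (auto simp: diff_ideal_gen_def)

lemma diff_ideal_sum:
  assumes "diff_ideal I" "\<And>x. x \<in> S \<Longrightarrow> f x \<in> I"
  shows "sum f S \<in> I"
  using assms(2)
  by (induction S rule: infinite_finite_induct) (use assms(1) in \<open>auto simp: diff_ideal_def\<close>)

lemma diff_ideal_act:
  assumes "diff_ideal I" "p \<in> I"
  shows "act dconst dpoly_der L p \<in> I"
proof -
  have "(dpoly_der ^^ i) p \<in> I" for i
    by (induction i) (use assms in \<open>auto simp: diff_ideal_def\<close>)
  then show ?thesis
    unfolding act_def using assms(1) by (intro diff_ideal_sum) (auto simp: diff_ideal_def)
qed

lemma (in diff_map) diff_ideal_kernel: "diff_ideal {p. deval h d \<eta> p = 0}"
  by (simp add: diff_ideal_def deval_dpoly_der)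

lemma (in diff_map) deval_diff_ideal_gen:
  assumes "deval h d \<eta> F = 0" "p \<in> diff_ideal_gen {F}"
  shows "deval h d \<eta> p = 0"
  using diff_ideal_gen_subset[OF diff_ideal_kernel, of "{F}" \<eta>] assms by auto

section \<open>Linear differential polynomials\<close>

definition linear_dpoly :: "'f::differential_field poly \<Rightarrow> 'f poly \<Rightarrow> 'f \<Rightarrow> (indet, 'f) dpoly" where
  "linear_dpoly L1 L2 a = op_apply L1 X + op_apply L2 Y + dconst a"

lemma (in diff_map) deval_linear_dpoly:
  "deval h d \<eta> (linear_dpoly L1 L2 a) = act h d L1 (\<eta> X) + act h d L2 (\<eta> Y) + h a"
  by (simp add: linear_dpoly_def deval_op_apply)

lemma op_apply_eq_sum_single:
  "op_apply L v = (\<Sum>i\<le>degree L. Poly_Mapping.single (Poly_Mapping.single (v, i) 1) (coeff L i))"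
  by (simp add: op_apply_def dconst_def dvar_def mult_single)

lemma partial_deriv_zero: "partial_deriv w 0 = 0"
  by (simp add: partial_deriv_def)

lemma partial_deriv_sum: "partial_deriv w (sum f S) = (\<Sum>x\<in>S. partial_deriv w (f x))"
  by (induction S rule: infinite_finite_induct) (auto simp: partial_deriv_add partial_deriv_zero)

lemma partial_deriv_op_apply:
  "partial_deriv w (op_apply L v)
    = (dconst (if fst w = v then coeff L (snd w) else 0) :: ('a, 'b::differential_field) dpoly)"
proof -
  have "partial_deriv w (op_apply L v) = (\<Sum>i\<le>degree L. if w = (v, i) then dconst (coeff L i) else 0)"
    unfolding op_apply_eq_sum_single partial_deriv_sum partial_deriv_single
    by (intro sum.cong refl) (auto simp: lookup_single dconst_def)
  also have "\<dots> = dconst (if fst w = v then coeff L (snd w) else 0)"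
  proof (cases "fst w = v")
    case True
    then have "(\<Sum>i\<le>degree L. if w = (v, i) then dconst (coeff L i) else 0)
        = (\<Sum>i\<le>degree L. if i = snd w then dconst (coeff L i) else (0 :: ('a, 'b) dpoly))"
      by (intro sum.cong) (auto simp: prod_eq_iff)
    then show ?thesis using True by (simp add: sum.delta coeff_eq_0)
  next
    case False
    then have "\<And>i. w \<noteq> (v, i)" by auto
    then show ?thesis using False by simp
  qed
  finally show ?thesis .
qed

lemma partial_deriv_dconst: "partial_deriv w (dconst a) = 0"
  by (simp add: dconst_def partial_deriv_single)

lemma dvars_op_apply: "dvars (op_apply L v) \<subseteq> {v} \<times> {k. coeff L k \<noteq> 0}"
proof -
  have "Poly_Mapping.keys (op_apply L v) \<subseteq>
      (\<Union>i\<le>degree L. Poly_Mapping.keys (Poly_Mapping.single (Poly_Mapping.single (v, i) 1) (coeff L i)))"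
    unfolding op_apply_eq_sum_single by (rule keys_sum)
  also have "\<dots> \<subseteq> {Poly_Mapping.single (v, i) 1 | i. coeff L i \<noteq> 0}"
    by auto
  finally show ?thesis by (auto simp: dvars_def)
qed

lemma dvars_dconst: "dvars (dconst a) = {}"
  by (auto simp: dvars_def dconst_def)

lemma dvars_empty_imp_const:
  assumes "dvars p = {}"
  shows "p \<in> range dconst"
proof -
  have "Poly_Mapping.keys p \<subseteq> {0}" using assms by (auto simp: dvars_def)
  then have "p = dconst (Poly_Mapping.lookup p 0)"
    by (intro poly_mapping_eqI) (auto simp: dconst_def lookup_single when_def in_keys_iff)
  then show ?thesis by blast
qed

lemma finite_linear_order_max:
  assumes "linear_order r" "finite S" "S \<noteq> {}"
  shows "\<exists>w\<in>S. \<forall>w'\<in>S. (w', w) \<in> r"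
  using assms(2,3)
proof (induction S rule: finite_ne_induct)
  case (singleton x)
  then show ?case using assms(1) by (auto simp: order_on_defs refl_on_def)
next
  case (insert x S)
  then obtain w where w: "w \<in> S" "\<forall>w'\<in>S. (w', w) \<in> r" by blast
  have refl: "(y, y) \<in> r" for y using assms(1) by (auto simp: order_on_defs refl_on_def)
  have tot: "(x, w) \<in> r \<or> (w, x) \<in> r"
    using assms(1) refl by (cases "x = w") (auto simp: order_on_defs total_on_def)
  have trans: "trans r" using assms(1) by (simp add: order_on_defs)
  show ?case
  proof (cases "(x, w) \<in> r")
    case True
    then show ?thesis using w by auto
  next
    case False
    then have "(w, x) \<in> r" using tot by blast
    then have "\<forall>w'\<in>insert x S. (w', x) \<in> r" using w(2) refl transD[OF trans] by blast
    then show ?thesis by blast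
  qed
qed

lemma leader_in_dvars:
  assumes "ranking r" "dvars A \<noteq> {}"
  shows "leader r A \<in> dvars A"
proof -
  have lin: "linear_order r" using assms by (simp add: ranking_def)
  obtain w where w: "w \<in> dvars A" "\<forall>w'\<in>dvars A. (w', w) \<in> r"
    using finite_linear_order_max[OF lin finite_dvars assms(2)] by blast
  have antisym: "antisym r" using lin by (simp add: order_on_defs)
  have "leader r A = w"
    unfolding leader_def
  proof (rule the_equality)
    show "w' = w" if "w' \<in> dvars A \<and> (\<forall>w''\<in>dvars A. (w'', w') \<in> r)" for w'
      using that w antisymD[OF antisym] by blast
  qed (use w in blast)
  then show ?thesis using w by simp
qed

text \<open>
  The partial derivative of a linear differential polynomial by a variable that occurs in it is the
  coefficient of this variable, a nonzero constant. Powers of the separant can thus be cancelled.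
\<close>
lemma sat_linear_dpoly:
  assumes "ranking r" and nonconst: "linear_dpoly L1 L2 a \<notin> range dconst"
  shows "sat r (linear_dpoly L1 L2 a) = diff_ideal_gen {linear_dpoly L1 L2 a}"
proof -
  let ?F = "linear_dpoly L1 L2 a"
  define w where "w = leader r ?F"
  have w: "w \<in> dvars ?F"
    unfolding w_def using dvars_empty_imp_const nonconst assms(1) by (intro leader_in_dvars) auto
  define s where "s = (if fst w = X then coeff L1 (snd w) else coeff L2 (snd w))"
  have "partial_deriv w ?F = dconst s"
    unfolding s_def linear_dpoly_def
    by (cases "fst w") (simp_all add: partial_deriv_add partial_deriv_op_apply partial_deriv_dconst)
  then have sep: "separant r ?F = dconst s" by (simp add: separant_def w_def)
  have "w \<in> dvars (op_apply L1 X) \<union> dvars (op_apply L2 Y)"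
    using w dvars_add[of "op_apply L1 X + op_apply L2 Y" "dconst a"]
      dvars_add[of "op_apply L1 X" "op_apply L2 Y"]
    unfolding linear_dpoly_def dvars_dconst by blast
  then have s: "s \<noteq> 0"
    using dvars_op_apply[of L1 X] dvars_op_apply[of L2 Y] by (auto simp: s_def)
  have ideal: "diff_ideal (diff_ideal_gen {?F})" by (rule diff_ideal_diff_ideal_gen)
  have "p \<in> diff_ideal_gen {?F}" if "dconst s ^ m * p \<in> diff_ideal_gen {?F}" for m p
  proof -
    have "dconst (1 / s) ^ m * (dconst s ^ m * p) \<in> diff_ideal_gen {?F}"
      using that ideal by (simp add: diff_ideal_def)
    moreover have "dconst (1 / s) ^ m * (dconst s ^ m * p) = (dconst (1 / s * s)) ^ m * p"
      by (simp only: dconst_simps power_mult_distrib mult.assoc)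
    ultimately show ?thesis using s by simp
  qed
  moreover have "\<exists>m. dconst s ^ m * p \<in> diff_ideal_gen {?F}" if "p \<in> diff_ideal_gen {?F}" for p
    using that by (intro exI[of _ 0]) simp
  ultimately show ?thesis by (auto simp: sat_def sep)
qed

lemma linear_dpoly_nonconst_operators:
  assumes "linear_dpoly L1 L2 a \<notin> range dconst"
  shows "L1 \<noteq> 0 \<or> L2 \<noteq> 0"
  using assms by (auto simp: linear_dpoly_def op_apply_def)

section \<open>Irreducibility of linear differential polynomials\<close>

text \<open>
  Any linear order of the indeterminates turns the exponents into an ordered monoid, from which it
  follows that the differential polynomial ring has no zero divisors.
\<close>
instantiation indet :: linorder
begin

definition less_eq_indet :: "indet \<Rightarrow> indet \<Rightarrow> bool" where
  "less_eq_indet v w \<longleftrightarrow> v = X \<or> w = Y"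

definition less_indet :: "indet \<Rightarrow> indet \<Rightarrow> bool" where
  "less_indet v w \<longleftrightarrow> v = X \<and> w = Y"

instance
proof
  fix v w z :: indet
  show "(v < w) = (v \<le> w \<and> \<not> w \<le> v)" "v \<le> v" "v \<le> w \<or> w \<le> v"
    by (cases v; cases w; simp add: less_eq_indet_def less_indet_def)+
  show "v \<le> w \<Longrightarrow> w \<le> z \<Longrightarrow> v \<le> z" "v \<le> w \<Longrightarrow> w \<le> v \<Longrightarrow> v = w"
    by (cases v; cases w; simp add: less_eq_indet_def)+
qed

end

text \<open>
  Multiplying each variable by a new variable \<open>t\<close> is a ring homomorphism, and the degree in \<open>t\<close> of
  the image is the total degree. Total degrees are therefore additive, like the degrees of univariate
  polynomials over a domain.
\<close>
definition homogenize :: "('v, 'a::comm_ring_1) dpoly \<Rightarrow> ('v, 'a) dpoly poly" where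
  "homogenize = peval (\<lambda>c. [:dconst c:]) (\<lambda>w. [:0, dvar w:])"

lemma comm_ring_map_homogenize_const:
  "comm_ring_map (\<lambda>c. [:dconst c :: ('v, 'a::comm_ring_1) dpoly:])"
  by standard (simp_all add: one_pCons)

lemma poly_homogenize:
  fixes p :: "('v, 'a::comm_ring_1) dpoly"
  shows "poly (homogenize p) t = peval dconst (\<lambda>w. t * dvar w) p"
proof (rule ring_map_eqI[where \<Phi> = "\<lambda>p. poly (homogenize p) t"])
  interpret comm_ring_map "\<lambda>c. [:dconst c :: ('v, 'a) dpoly:]"
    by (rule comm_ring_map_homogenize_const)
  interpret c: comm_ring_map "dconst :: 'a \<Rightarrow> ('v, 'a) dpoly" by (rule comm_ring_map_dconst)
  show "comm_ring_map (\<lambda>p :: ('v, 'a) dpoly. poly (homogenize p) t)"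
    unfolding homogenize_def by (rule comm_ring_map_comp[OF comm_ring_map_peval]) (standard, simp_all)
  show "comm_ring_map (peval dconst (\<lambda>w. t * dvar w :: ('v, 'a) dpoly))"
    by (rule c.comm_ring_map_peval)
  show "poly (homogenize (dconst c)) t = peval dconst (\<lambda>w. t * dvar w) (dconst c)" for c
    by (simp add: homogenize_def)
  show "poly (homogenize (dvar w)) t = peval dconst (\<lambda>w. t * dvar w) (dvar w)" for w
    by (simp add: homogenize_def)
qed

lemma homogenize_degree_0_imp_const:
  fixes p :: "('v, 'a::comm_ring_1) dpoly"
  assumes "degree (homogenize p) = 0"
  shows "p \<in> range dconst"
proof -
  have id: "comm_ring_map (\<lambda>c :: 'a. c)" by standard simp_all
  interpret c: comm_ring_map "dconst :: 'a \<Rightarrow> ('v, 'a) dpoly" by (rule comm_ring_map_dconst)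
  obtain e where "homogenize p = [:e:]" using assms by (rule degree_eq_zeroE)
  \<comment> \<open>If \<open>t\<close> does not occur, its values 1 and 0 give the same result: \<open>p\<close> itself and its constant term.\<close>
  then have "poly (homogenize p) 1 = poly (homogenize p) 0" by simp
  then have "p = peval dconst (\<lambda>w. 0) p"
    by (simp add: poly_homogenize peval_dconst_dvar)
  also have "\<dots> = dconst (peval (\<lambda>c. c) (\<lambda>w. 0) p)"
    by (rule ring_map_eqI[where \<Phi> = "peval dconst (\<lambda>w. 0)" and \<Psi> = "\<lambda>p. dconst (peval (\<lambda>c. c) (\<lambda>w. 0) p)",
          OF c.comm_ring_map_peval comm_ring_map_comp[OF comm_ring_map.comm_ring_map_peval[OF id] comm_ring_map_dconst]])
      (simp_all add: comm_ring_map.peval_dconst[OF id] comm_ring_map.peval_dvar[OF id])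
  finally show ?thesis by (metis rangeI)
qed

text \<open>
  In a factorization the total degrees add up to 1, so one factor has total degree 0 and is a nonzero
  constant.
\<close>
lemma irreducible_linear_dpoly:
  assumes nonconst: "linear_dpoly L1 L2 (a :: 'f::differential_field) \<notin> range dconst"
  shows "irreducible (linear_dpoly L1 L2 a)"
proof -
  let ?F = "linear_dpoly L1 L2 a"
  interpret comm_ring_map "\<lambda>c. [:dconst c :: (indet, 'f) dpoly:]"
    by (rule comm_ring_map_homogenize_const)
  interpret hom: comm_ring_map "homogenize :: (indet, 'f) dpoly \<Rightarrow> _"
    unfolding homogenize_def by (rule comm_ring_map_peval)
  have hom_dconst: "homogenize (dconst c) = [:dconst c :: (indet, 'f) dpoly:]" for c :: 'f
    by (simp add: homogenize_def)
  have hom_dvar: "homogenize (dvar w) = [:0, dvar w :: (indet, 'f) dpoly:]" for w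
    by (simp add: homogenize_def)
  have "degree (homogenize (op_apply L v)) \<le> 1" for L :: "'f poly" and v :: indet
    unfolding op_apply_def hom.h_sum hom.h_mult hom_dconst hom_dvar
    by (intro degree_sum_le) auto
  then have deg_F: "degree (homogenize ?F) \<le> 1"
    unfolding linear_dpoly_def hom.h_add by (intro degree_add_le) (auto simp: hom_dconst)
  have nz: "homogenize p \<noteq> 0" if "p \<noteq> 0" for p :: "(indet, 'f) dpoly"
  proof
    assume "homogenize p = 0"
    then have "poly (homogenize p) 1 = 0" by simp
    then show False using that by (simp add: poly_homogenize peval_dconst_dvar)
  qed
  have F: "?F \<noteq> 0" using nonconst by (metis dconst_simps(1) rangeI)
  have unit: "p dvd 1" if "p \<noteq> 0" and deg: "degree (homogenize p) = 0" for p :: "(indet, 'f) dpoly"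
  proof -
    obtain c where c: "p = dconst c" using homogenize_degree_0_imp_const[OF deg] by blast
    then have "c \<noteq> 0" using \<open>p \<noteq> 0\<close> by auto
    then have "p * dconst (1 / c) = 1"
      by (simp only: c flip: dconst_simps(4)) simp
    then show ?thesis by (metis dvd_triv_left)
  qed
  have degree_mult: "degree (homogenize p) + degree (homogenize q) = degree (homogenize (p * q))"
    if "p \<noteq> 0" "q \<noteq> 0" for p q :: "(indet, 'f) dpoly"
    unfolding hom.h_mult by (intro degree_mult_eq[symmetric] nz that)
  show ?thesis
  proof (rule irreducibleI[OF F])
    show "\<not> ?F dvd 1"
    proof
      assume "?F dvd 1"
      then obtain q where q: "1 = ?F * q" by (auto simp: dvd_def)
      then have "q \<noteq> 0" by auto
      with degree_mult[OF F this] have "degree (homogenize ?F) = 0"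
        by (simp flip: q)
      then show False using homogenize_degree_0_imp_const nonconst by blast
    qed
  next
    fix p q assume pq: "?F = p * q"
    then have nz': "p \<noteq> 0" "q \<noteq> 0" using F by auto
    have "degree (homogenize p) + degree (homogenize q) \<le> 1"
      using degree_mult[OF nz'] deg_F pq by simp
    then have "degree (homogenize p) = 0 \<or> degree (homogenize q) = 0" by linarith
    then show "p dvd 1 \<or> q dvd 1" using unit nz' by blast
  qed
qed

section \<open>Linearity and total degree\<close>

lemma total_degree_le_iff:
  "total_degree p \<le> n \<longleftrightarrow>
     (\<forall>m\<in>Poly_Mapping.keys p. (\<Sum>w\<in>Poly_Mapping.keys m. Poly_Mapping.lookup m w) \<le> n)"
  unfolding total_degree_def by (subst Max_le_iff) auto

lemma degree_le_1_exponent: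
  fixes m :: "'k \<Rightarrow>\<^sub>0 nat"
  assumes "(\<Sum>w\<in>Poly_Mapping.keys m. Poly_Mapping.lookup m w) \<le> 1"
  shows "m = 0 \<or> (\<exists>w. m = Poly_Mapping.single w 1)"
proof (cases "Poly_Mapping.keys m = {}")
  case False
  then obtain w where w: "w \<in> Poly_Mapping.keys m" by blast
  have pos: "Poly_Mapping.lookup m w \<ge> 1" using w by (simp add: in_keys_iff Suc_le_eq)
  have total: "Poly_Mapping.lookup m w + (\<Sum>x\<in>Poly_Mapping.keys m - {w}. Poly_Mapping.lookup m x) \<le> 1"
    using assms w by (simp add: sum.remove)
  then have "(\<Sum>x\<in>Poly_Mapping.keys m - {w}. Poly_Mapping.lookup m x) = 0" using pos by linarith
  then have "\<forall>x\<in>Poly_Mapping.keys m - {w}. Poly_Mapping.lookup m x = 0"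
    by (simp only: sum_eq_0_iff finite_Diff finite_keys)
  then have "Poly_Mapping.lookup m x = 0" if "x \<noteq> w" for x
    using that by (cases "x \<in> Poly_Mapping.keys m") (simp_all add: not_in_keys_iff_lookup_eq_zero)
  moreover have "Poly_Mapping.lookup m w = 1" using total pos by linarith
  ultimately have "m = Poly_Mapping.single w 1"
    by (intro poly_mapping_eqI) (auto simp: lookup_single when_def)
  then show ?thesis by blast
qed simp

lemma op_apply_add: "op_apply (L + M) v = op_apply L v + op_apply M v"
  unfolding op_apply_eq_act by (rule diff_map.act_add_left[OF diff_map_dpoly_der])

lemma total_degree_1_linear_dpoly:
  assumes "total_degree (A :: (indet, 'f::differential_field) dpoly) \<le> 1"
  obtains L1 L2 a where "A = linear_dpoly L1 L2 a"
proof -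
  define linear where "linear p \<longleftrightarrow> (\<exists>L1 L2 a. p = linear_dpoly L1 L2 a)" for p :: "(indet, 'f) dpoly"
  have zero: "linear 0"
    unfolding linear_def by (intro exI[of _ 0]) (simp add: linear_dpoly_def op_apply_def)
  have add: "linear (p + q)" if "linear p" "linear q" for p q
  proof -
    have "linear_dpoly L1 L2 a + linear_dpoly M1 M2 b = linear_dpoly (L1 + M1) (L2 + M2) (a + b)"
      for L1 L2 M1 M2 and a b :: 'f
      by (simp add: linear_dpoly_def op_apply_add algebra_simps)
    then show ?thesis using that unfolding linear_def by metis
  qed
  have op_apply_monom: "op_apply (monom c k) v = (Poly_Mapping.single (Poly_Mapping.single (v, k) 1) c
      :: (indet, 'f) dpoly)" for c k v
  proof (cases "c = 0")
    case False
    have "op_apply (monom c k) v = (\<Sum>i\<le>k. if i = k then Poly_Mapping.single (Poly_Mapping.single (v, k) 1) c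
        else (0 :: (indet, 'f) dpoly))"
      unfolding op_apply_eq_sum_single degree_monom_eq[OF False] by (intro sum.cong) auto
    then show ?thesis by simp
  qed (simp add: op_apply_def)
  have single: "linear (Poly_Mapping.single m c)" if "m \<in> Poly_Mapping.keys A" for m c
  proof -
    consider "m = 0" | v k where "m = Poly_Mapping.single (v, k) 1"
      using degree_le_1_exponent[of m] assms \<open>m \<in> Poly_Mapping.keys A\<close>
      by (auto simp: total_degree_le_iff)
    then show ?thesis
    proof cases
      case 1
      then have "Poly_Mapping.single m c = linear_dpoly 0 0 c"
        by (simp add: linear_dpoly_def op_apply_def dconst_def)
      then show ?thesis unfolding linear_def by blast
    next
      case 2
      have "Poly_Mapping.single m c = (if v = X then linear_dpoly (monom c k) 0 0 else linear_dpoly 0 (monom c k) 0)"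
        using 2 by (cases v) (simp_all add: linear_dpoly_def op_apply_monom, simp_all add: op_apply_def)
      then show ?thesis unfolding linear_def by metis
    qed
  qed
  have "linear (\<Sum>m\<in>S. Poly_Mapping.single m (Poly_Mapping.lookup A m))"
    if "finite S" "S \<subseteq> Poly_Mapping.keys A" for S
    using that by (induction S) (auto intro: zero add single)
  from this[of "Poly_Mapping.keys A"] have "linear A"
    by (simp add: poly_mapping_eq_sum_single)
  then show ?thesis using that unfolding linear_def by blast
qed

lemma total_degree_op_apply_le: "total_degree (op_apply L v + dconst a) \<le> 1"
proof -
  have "Poly_Mapping.keys (op_apply L v) \<subseteq>
      (\<Union>i\<le>degree L. Poly_Mapping.keys (Poly_Mapping.single (Poly_Mapping.single (v, i) 1) (coeff L i)))"
    unfolding op_apply_eq_sum_single by (rule keys_sum)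
  moreover have "Poly_Mapping.keys (dconst a) \<subseteq> {0}" by (simp add: dconst_def)
  ultimately have "Poly_Mapping.keys (op_apply L v + dconst a) \<subseteq>
      insert 0 (range (\<lambda>i. Poly_Mapping.single (v, i) 1))"
    using keys_add[of "op_apply L v" "dconst a"] by (auto split: if_splits)
  then show ?thesis unfolding total_degree_le_iff by auto
qed

section \<open>Parametrizations of linear curves with coprime operators\<close>

text \<open>
  The two coordinate changes are inverse to each other in every differential algebra.
\<close>
lemma (in diff_map) act_unimodular_reduction:
  assumes "unimodular_reduction L1 L2 D U V M1 M2 E1 E2 N1 N2"
  shows "act h d E1 (act h d U z + act h d M1 t) + act h d E2 (act h d V z + act h d M2 t) = z"
    and "act h d N1 (act h d U z + act h d M1 t) + act h d N2 (act h d V z + act h d M2 t) = t"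
    and "act h d U (act h d E1 x + act h d E2 y) + act h d M1 (act h d N1 x + act h d N2 y) = x"
    and "act h d V (act h d E1 x + act h d E2 y) + act h d M2 (act h d N1 x + act h d N2 y) = y"
proof -
  have combine: "act h d A1 (act h d B1 z + act h d C1 t) + act h d A2 (act h d B2 z + act h d C2 t)
    = act h d (A1 \<star> B1 + A2 \<star> B2) z + act h d (A1 \<star> C1 + A2 \<star> C2) t"
    for A1 A2 B1 B2 C1 C2 z t
    by (simp add: act_add_left act_add_right act_op_mult algebra_simps)
  show "act h d E1 (act h d U z + act h d M1 t) + act h d E2 (act h d V z + act h d M2 t) = z"
    "act h d N1 (act h d U z + act h d M1 t) + act h d N2 (act h d V z + act h d M2 t) = t"
    "act h d U (act h d E1 x + act h d E2 y) + act h d M1 (act h d N1 x + act h d N2 y) = x"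
    "act h d V (act h d E1 x + act h d E2 y) + act h d M2 (act h d N1 x + act h d N2 y) = y"
    using assms unfolding combine by (simp_all add: unimodular_reduction_def)
qed

lemma (in diff_map) act_base: "act h d L (h c) = h (act (\<lambda>c. c) der L c)"
proof -
  have "(d ^^ i) (h c) = h ((der ^^ i) c)" for i
    by (induction i) (simp_all add: h_der)
  then show ?thesis by (simp add: act_def h_sum)
qed

text \<open>
  Substitution by elements congruent to the indeterminates modulo a differential ideal changes nothing
  modulo this ideal: the differential polynomials for which this holds are closed under all operations.
\<close>
lemma diff_ideal_deval_cong:
  assumes I: "diff_ideal I" and gen: "\<And>v. dvar (v, 0) - \<xi> v \<in> I"
  shows "p - deval dconst dpoly_der \<xi> p \<in> (I :: ('v, 'a::differential_field) dpoly set)"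
proof -
  interpret diff_map "dconst :: 'a \<Rightarrow> ('v, 'a) dpoly" dpoly_der by (rule diff_map_dpoly_der)
  have der: "dpoly_der p \<in> I" if "p \<in> I" for p
    using that I by (auto simp: diff_ideal_def)
  show ?thesis
  proof (induction p rule: dpoly_induct)
    case (dconst c)
    then show ?case using I by (simp add: diff_ideal_def)
  next
    case (dvar w)
    have "dvar (v, k) - (dpoly_der ^^ k) (\<xi> v) \<in> I" for v k
    proof (induction k)
      case (Suc k)
      have "dpoly_der (dvar (v, k) - (dpoly_der ^^ k) (\<xi> v))
          = dvar (v, Suc k) - (dpoly_der ^^ Suc k) (\<xi> v)"
        by (simp add: diff_conv_add_uminus d_add d_minus del: add_uminus_conv_diff)
          (simp add: dpoly_der_eq)
      then show ?case using Suc der by metis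
    qed (simp add: gen)
    then show ?case by (cases w) simp
  next
    case (add p q)
    then have "(p - deval dconst dpoly_der \<xi> p) + (q - deval dconst dpoly_der \<xi> q) \<in> I"
      using I by (auto simp: diff_ideal_def)
    then show ?case by (simp add: algebra_simps)
  next
    case (mult p q)
    then have "q * (p - deval dconst dpoly_der \<xi> p)
        + deval dconst dpoly_der \<xi> p * (q - deval dconst dpoly_der \<xi> q) \<in> I"
      using I by (auto simp: diff_ideal_def)
    then show ?case by (simp add: algebra_simps)
  qed
qed

lemma diff_subfield_deval:
  assumes emb: "diff_embedding \<iota>" and K: "diff_subfield K" "range \<iota> \<subseteq> K" "range \<eta> \<subseteq> K"
  shows "deval \<iota> der \<eta> p \<in> K"
proof -
  interpret diff_map \<iota> der using emb by (rule diff_map_embedding)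
  show ?thesis
  proof (induction p rule: dpoly_induct)
    case (dvar w)
    have "(der ^^ k) (\<eta> v) \<in> K" for v k
      by (induction k) (use K in \<open>auto simp: diff_subfield_def\<close>)
    then show ?case by simp
  qed (use K in \<open>auto simp: diff_subfield_def\<close>)
qed

lemma adjoin_subset:
  assumes "diff_subfield K" "range \<iota> \<subseteq> K" "S \<subseteq> K"
  shows "adjoin \<iota> S \<subseteq> K"
  using assms by (auto simp: adjoin_def)

lemma diff_subfield_adjoin: "diff_subfield (adjoin \<iota> S)"
  by (auto simp: adjoin_def diff_subfield_def)

lemma range_subset_adjoin: "range \<iota> \<subseteq> adjoin \<iota> S"
  and subset_adjoin: "S \<subseteq> adjoin \<iota> S"
  by (auto simp: adjoin_def)

lemma deval_in_adjoin:
  assumes "diff_embedding \<iota>" "range \<eta> \<subseteq> adjoin \<iota> S"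
  shows "deval \<iota> der \<eta> p \<in> adjoin \<iota> S"
  using diff_subfield_deval[OF assms(1) diff_subfield_adjoin range_subset_adjoin assms(2)] .

text \<open>
  With \<open>D = 1\<close> the first new coordinate is \<open>L1(x) + L2(y)\<close>, which is \<open>-a\<close> on the curve, and the second one
  is free. The point \<open>P\<close> has coordinates \<open>-a\<close> and \<open>u\<close> in the new system.
\<close>
lemma proper_parametrization:
  fixes \<iota> :: "'f::differential_field \<Rightarrow> 'e::differential_field"
  assumes emb: "diff_embedding \<iota>" and transc: "diff_transcendental \<iota> u" and r: "ranking r"
    and nonconst: "linear_dpoly L1 L2 a \<notin> range dconst" and coprime: "gcld L1 L2 = 1"
  shows "\<exists>P. rational_parametrization \<iota> u r (linear_dpoly L1 L2 a) P \<and> proper \<iota> u P \<and>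
    linear_polynomial_point \<iota> u P"
proof -
  let ?F = "linear_dpoly L1 L2 a"
  obtain U V M1 M2 E1 E2 N1 N2 where red: "unimodular_reduction L1 L2 1 U V M1 M2 E1 E2 N1 N2"
    using gcld_unimodular_reduction[OF linear_dpoly_nonconst_operators[OF nonconst]] coprime by auto
  have E: "E1 = L1" "E2 = L2" using red by (simp_all add: unimodular_reduction_def)
  interpret E: diff_map \<iota> der using emb by (rule diff_map_embedding)
  interpret S: diff_map "dconst :: 'f \<Rightarrow> (unit, 'f) dpoly" dpoly_der by (rule diff_map_dpoly_der)
  interpret T: diff_map "dconst :: 'f \<Rightarrow> (indet, 'f) dpoly" dpoly_der by (rule diff_map_dpoly_der)
  define \<theta> :: "indet \<Rightarrow> (unit, 'f) dpoly" where
    "\<theta> v = (case v of X \<Rightarrow> op_apply M1 () + dconst (- act (\<lambda>c. c) der U a)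
                  | Y \<Rightarrow> op_apply M2 () + dconst (- act (\<lambda>c. c) der V a))" for v
  define P where "P v = dpoly_eval \<iota> (\<lambda>_. u) (\<theta> v)" for v
  have P: "P = (\<lambda>v. deval \<iota> der (\<lambda>_. u) (\<theta> v))"
    by (simp add: fun_eq_iff P_def dpoly_eval_eq_deval)
  have PX: "P X = act \<iota> der U (- \<iota> a) + act \<iota> der M1 u"
    and PY: "P Y = act \<iota> der V (- \<iota> a) + act \<iota> der M2 u"
    by (simp_all add: P \<theta>_def E.deval_op_apply E.act_base E.act_minus_right del: dconst_simps)
  have P_on_curve: "deval \<iota> der P ?F = 0"
    using E.act_unimodular_reduction(1)[OF red, of "- \<iota> a" u]
    by (simp add: E.deval_linear_dpoly PX PY E)
  have u_from_P: "u = deval \<iota> der P (op_apply N1 X + op_apply N2 Y)"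
    using E.act_unimodular_reduction(2)[OF red, of "- \<iota> a" u]
    by (simp add: E.deval_op_apply PX PY)

  define t :: "(indet, 'f) dpoly" where "t = op_apply N1 X + op_apply N2 Y"
  define I where "I = diff_ideal_gen {?F}"
  have I: "diff_ideal I" "?F \<in> I"
    unfolding I_def using diff_ideal_diff_ideal_gen subset_diff_ideal_gen by auto
  \<comment> \<open>Substituting the parametrization into \<open>x, y\<close> and then \<open>N1(x) + N2(y)\<close> for its parameter moves \<open>x\<close> by \<open>U(F)\<close> and \<open>y\<close> by \<open>V(F)\<close>.\<close>
  have retract: "dvar (v, 0) - deval dconst dpoly_der (\<lambda>_. t) (\<theta> v) \<in> I" for v
  proof -
    have t: "t = act dconst dpoly_der N1 (dvar (X, 0)) + act dconst dpoly_der N2 (dvar (Y, 0))"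
      by (simp add: t_def op_apply_eq_act)
    have F: "?F = act dconst dpoly_der L1 (dvar (X, 0)) + act dconst dpoly_der L2 (dvar (Y, 0)) + dconst a"
      by (simp add: linear_dpoly_def op_apply_eq_act)
    have "dvar (X, 0) - deval dconst dpoly_der (\<lambda>_. t) (\<theta> X) = act dconst dpoly_der U ?F"
      using T.act_unimodular_reduction(3)[OF red, of "dvar (X, 0)" "dvar (Y, 0)", folded t]
      unfolding F E
      by (simp add: \<theta>_def T.deval_op_apply T.act_base T.act_add_right algebra_simps)
    moreover have "dvar (Y, 0) - deval dconst dpoly_der (\<lambda>_. t) (\<theta> Y) = act dconst dpoly_der V ?F"
      using T.act_unimodular_reduction(4)[OF red, of "dvar (X, 0)" "dvar (Y, 0)", folded t]
      unfolding F E
      by (simp add: \<theta>_def T.deval_op_apply T.act_base T.act_add_right algebra_simps)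
    ultimately show ?thesis using diff_ideal_act[OF I] by (cases v) metis+
  qed
  have generic: "p \<in> I" if "deval \<iota> der P p = 0" for p
  proof -
    have "deval \<iota> der (\<lambda>_. u) (deval dconst dpoly_der \<theta> p) = 0"
      using that by (simp add: P deval_deval[OF E.diff_map_axioms])
    then have "deval dconst dpoly_der \<theta> p = 0"
      using transc by (simp add: diff_transcendental_def dpoly_eval_eq_deval)
    moreover have "p - deval dconst dpoly_der (\<lambda>_. t) (deval dconst dpoly_der \<theta> p) \<in> I"
      unfolding deval_deval[OF diff_map_dpoly_der]
      by (rule diff_ideal_deval_cong[OF I(1) retract])
    ultimately show ?thesis by simp
  qed
  have "vanishing_ideal \<iota> P = I"
    using generic E.deval_diff_ideal_gen[OF P_on_curve]
    by (auto simp: vanishing_ideal_def dpoly_eval_eq_deval I_def)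
  moreover have P_in: "range P \<subseteq> adjoin \<iota> {u}"
    using deval_in_adjoin[OF emb, of "\<lambda>_. u" "{u}"] subset_adjoin[of "{u}" \<iota>] by (auto simp: P)
  ultimately have "rational_parametrization \<iota> u r ?F P"
    using sat_linear_dpoly[OF r nonconst] by (simp add: rational_parametrization_def I_def)
  moreover have "proper \<iota> u P"
    unfolding proper_def
  proof (rule antisym)
    show "adjoin \<iota> (range P) \<subseteq> adjoin \<iota> {u}"
      by (intro adjoin_subset diff_subfield_adjoin range_subset_adjoin P_in)
    have "u \<in> adjoin \<iota> (range P)"
      by (subst u_from_P) (intro deval_in_adjoin emb subset_adjoin)
    then show "adjoin \<iota> {u} \<subseteq> adjoin \<iota> (range P)"
      by (intro adjoin_subset diff_subfield_adjoin range_subset_adjoin) simp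
  qed
  moreover have "linear_polynomial_point \<iota> u P"
  proof -
    have "total_degree (\<theta> v) \<le> 1" for v
      unfolding \<theta>_def by (cases v) (simp_all only: indet.case total_degree_op_apply_le)
    then show ?thesis unfolding linear_polynomial_point_def P_def by blast
  qed
  ultimately show ?thesis by blast
qed

section \<open>Solutions of linear differential equations in a purely transcendental extension\<close>

lemma der_inverse: "y \<noteq> 0 \<Longrightarrow> der (inverse y) = - der y / (y * y :: 'e::differential_field)"
proof -
  assume y: "y \<noteq> 0"
  have "der (y * inverse y) = 0" using y by simp
  then have "y * der (inverse y) = - (der y * inverse y)"
    by (simp add: der_mult eq_neg_iff_add_eq_0 add.commute)
  then have "inverse y * (y * der (inverse y)) = inverse y * - (der y * inverse y)" by simp
  then show ?thesis using y by (simp add: field_simps)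
qed

lemma der_divide:
  "y \<noteq> 0 \<Longrightarrow> der (x / y) = (der x * y - x * der y) / (y * y :: 'e::differential_field)"
  by (simp add: divide_inverse der_mult der_inverse) (simp add: field_simps)

lemma der_poly: "der (poly p x) = poly (map_poly der p) x + poly (pderiv p) x * der x"
proof (induction p)
  case (pCons c p)
  then show ?case by (simp add: map_poly_pCons pderiv_pCons der_add der_mult algebra_simps)
qed simp

lemma degree_eq_of_wronskian_eq_0:
  fixes p q :: "'a::field_char_0 poly"
  assumes "pderiv p * q = p * pderiv q" "p \<noteq> 0" "q \<noteq> 0"
  shows "degree p = degree q"
proof -
  have lead: "lead_coeff (pderiv s) = of_nat (degree s) * lead_coeff s" for s :: "'a poly"
  proof (cases "degree s")
    case 0
    then have "pderiv s = 0" by (simp add: pderiv_eq_0_iff)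
    then show ?thesis using 0 by simp
  next
    case (Suc n)
    then show ?thesis by (simp add: degree_pderiv coeff_pderiv)
  qed
  have "lead_coeff (pderiv p * q) = lead_coeff (p * pderiv q)" using assms(1) by (rule arg_cong)
  then show ?thesis using assms(2,3) unfolding lead_coeff_mult lead by simp
qed

text \<open>
  If \<open>p\<close> and \<open>q\<close> have vanishing Wronskian, so have \<open>q\<close> and the difference of \<open>p\<close> and the multiple of
  \<open>q\<close> with the same leading coefficient. By the comparison of degrees this difference, having smaller
  degree, is zero.
\<close>
lemma wronskian_eq_0_imp_proportional:
  fixes p q :: "'a::field_char_0 poly"
  assumes eq: "pderiv p * q = p * pderiv q" and q: "q \<noteq> 0"
  shows "p = smult (lead_coeff p / lead_coeff q) q"
proof (cases "p = 0")
  case False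
  let ?c = "lead_coeff p / lead_coeff q"
  let ?s = "p - smult ?c q"
  have deg: "degree p = degree q" using degree_eq_of_wronskian_eq_0[OF eq False q] .
  have "pderiv ?s * q = ?s * pderiv q"
    using eq by (simp add: pderiv_diff pderiv_smult algebra_simps)
  then have "?s = 0 \<or> degree ?s = degree q" using degree_eq_of_wronskian_eq_0 q by blast
  moreover have "coeff ?s (degree q) = 0" using q deg by simp
  ultimately show ?thesis by (metis eq_iff_diff_eq_0 leading_coeff_0_iff)
qed simp

definition subring :: "'e::comm_ring_1 set \<Rightarrow> bool" where
  "subring R \<longleftrightarrow> 1 \<in> R \<and> (\<forall>a\<in>R. \<forall>b\<in>R. a - b \<in> R \<and> a * b \<in> R)"

lemma subringD:
  assumes "subring R"
  shows "0 \<in> R" "1 \<in> R" "a \<in> R \<Longrightarrow> b \<in> R \<Longrightarrow> a + b \<in> R"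
    "a \<in> R \<Longrightarrow> b \<in> R \<Longrightarrow> a - b \<in> R" "a \<in> R \<Longrightarrow> b \<in> R \<Longrightarrow> a * b \<in> R"
proof -
  have one: "1 \<in> R" and diff: "\<And>a b. a \<in> R \<Longrightarrow> b \<in> R \<Longrightarrow> a - b \<in> R"
    and mult: "\<And>a b. a \<in> R \<Longrightarrow> b \<in> R \<Longrightarrow> a * b \<in> R"
    using assms by (auto simp: subring_def)
  have zero: "0 \<in> R" using diff[OF one one] by simp
  have "a + b \<in> R" if "a \<in> R" "b \<in> R"
    using diff[OF that(1) diff[OF zero that(2)]] by simp
  then show "0 \<in> R" "1 \<in> R" "a \<in> R \<Longrightarrow> b \<in> R \<Longrightarrow> a + b \<in> R"
    "a \<in> R \<Longrightarrow> b \<in> R \<Longrightarrow> a - b \<in> R" "a \<in> R \<Longrightarrow> b \<in> R \<Longrightarrow> a * b \<in> R"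
    using zero one diff mult by auto
qed

lemma subring_sum: "subring R \<Longrightarrow> (\<And>x. x \<in> S \<Longrightarrow> f x \<in> R) \<Longrightarrow> sum f S \<in> R"
  by (induction S rule: infinite_finite_induct) (auto intro: subringD)

lemma subring_of_nat: "subring R \<Longrightarrow> of_nat n \<in> R"
  by (induction n) (auto intro: subringD)

lemma subring_poly:
  assumes "subring R" "\<And>i. coeff p i \<in> R" "x \<in> R"
  shows "poly p x \<in> R"
proof -
  have "x ^ i \<in> R" for i by (induction i) (auto intro: subringD assms)
  then show ?thesis unfolding poly_altdef by (auto intro!: subring_sum subringD assms)
qed

lemma subring_coeff_mult:
  "subring R \<Longrightarrow> (\<And>i. coeff p i \<in> R) \<Longrightarrow> (\<And>i. coeff q i \<in> R) \<Longrightarrow> coeff (p * q) i \<in> R"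
  unfolding coeff_mult by (auto intro!: subring_sum subringD)

lemma subring_coeff_pderiv:
  "subring R \<Longrightarrow> (\<And>i. coeff p i \<in> R) \<Longrightarrow> coeff (pderiv p) i \<in> R"
  unfolding coeff_pderiv by (intro subringD subring_of_nat)

text \<open>
  The subring generated by the first \<open>n\<close> members of \<open>u, der u, der (der u), \<dots>\<close> over the base field.
  The recursion exhibits each element as a univariate polynomial in the highest derivative, so that
  the order of an element can be discussed with univariate polynomials alone.
\<close>
primrec jet_ring :: "('f::differential_field \<Rightarrow> 'e::differential_field) \<Rightarrow> 'e \<Rightarrow> nat \<Rightarrow> 'e set" where
  "jet_ring \<iota> u 0 = range \<iota>"
| "jet_ring \<iota> u (Suc n) = {poly p ((der ^^ n) u) | p. \<forall>i. coeff p i \<in> jet_ring \<iota> u n}"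

definition jet_field :: "('f::differential_field \<Rightarrow> 'e::differential_field) \<Rightarrow> 'e \<Rightarrow> nat \<Rightarrow> 'e set" where
  "jet_field \<iota> u n = {x / y | x y. x \<in> jet_ring \<iota> u n \<and> y \<in> jet_ring \<iota> u n \<and> y \<noteq> 0}"

context
  fixes \<iota> :: "'f::differential_field \<Rightarrow> 'e::differential_field" and u :: 'e
  assumes emb: "diff_embedding \<iota>"
begin

interpretation diff_map \<iota> der
  using emb by (rule diff_map_embedding)

lemma poly_in_jet_ring:
  "(\<And>i. coeff p i \<in> jet_ring \<iota> u n) \<Longrightarrow> poly p ((der ^^ n) u) \<in> jet_ring \<iota> u (Suc n)"
  by auto

lemma subring_jet_ring: "subring (jet_ring \<iota> u n)"
proof (induction n)
  case 0
  show ?case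
    unfolding subring_def jet_ring.simps
    by (metis h_diff h_mult h_one rangeE rangeI)
next
  case (Suc n)
  show ?case
    unfolding subring_def
  proof (intro conjI ballI)
    show "1 \<in> jet_ring \<iota> u (Suc n)"
      using Suc by (auto intro!: exI[of _ 1] simp: subringD)
    fix a b assume "a \<in> jet_ring \<iota> u (Suc n)" "b \<in> jet_ring \<iota> u (Suc n)"
    then obtain p q where p: "a = poly p ((der ^^ n) u)" "\<And>i. coeff p i \<in> jet_ring \<iota> u n"
      and q: "b = poly q ((der ^^ n) u)" "\<And>i. coeff q i \<in> jet_ring \<iota> u n" by auto
    have "coeff (p - q) i \<in> jet_ring \<iota> u n" for i
      using subringD(4)[OF Suc] p q by simp
    from poly_in_jet_ring[OF this] show "a - b \<in> jet_ring \<iota> u (Suc n)"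
      using p(1) q(1) by (simp only: poly_diff)
    have "coeff (p * q) i \<in> jet_ring \<iota> u n" for i
      using subring_coeff_mult[OF Suc] p q by simp
    from poly_in_jet_ring[OF this] show "a * b \<in> jet_ring \<iota> u (Suc n)"
      using p(1) q(1) by (simp only: poly_mult)
  qed
qed

lemma jet_ring_Suc: "x \<in> jet_ring \<iota> u n \<Longrightarrow> x \<in> jet_ring \<iota> u (Suc n)"
  using subringD(1)[OF subring_jet_ring, of n]
  by (auto intro!: exI[of _ "[:x:]"] simp: coeff_pCons split: nat.splits)

lemma jet_in_jet_ring: "(der ^^ n) u \<in> jet_ring \<iota> u (Suc n)"
  using subringD(1,2)[OF subring_jet_ring, of n]
  by (auto intro!: exI[of _ "[:0, 1:]"] simp: coeff_pCons split: nat.splits)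

lemma jet_ring_der: "x \<in> jet_ring \<iota> u n \<Longrightarrow> der x \<in> jet_ring \<iota> u (Suc n)"
  and jet_ring_der_coeffs: "(\<And>i. coeff p i \<in> jet_ring \<iota> u n) \<Longrightarrow>
    poly (map_poly der p) ((der ^^ n) u) \<in> jet_ring \<iota> u (Suc n)"
proof -
  have map: "poly (map_poly der p) ((der ^^ n) u) \<in> jet_ring \<iota> u (Suc n)"
    if "\<And>x. x \<in> jet_ring \<iota> u n \<Longrightarrow> der x \<in> jet_ring \<iota> u (Suc n)"
      "\<And>i. coeff p i \<in> jet_ring \<iota> u n" for n p
    by (rule subring_poly[OF subring_jet_ring _ jet_in_jet_ring])
      (use that in \<open>auto simp: coeff_map_poly\<close>)
  show der: "der x \<in> jet_ring \<iota> u (Suc n)" if "x \<in> jet_ring \<iota> u n" for x n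
    using that
  proof (induction n arbitrary: x)
    case 0
    then obtain c where "x = \<iota> c" by auto
    then have "der x \<in> jet_ring \<iota> u 0" by (simp flip: h_der)
    then show ?case by (rule jet_ring_Suc)
  next
    case (Suc n)
    then obtain p where p: "x = poly p ((der ^^ n) u)" "\<And>i. coeff p i \<in> jet_ring \<iota> u n" by auto
    have "poly (map_poly der p) ((der ^^ n) u) \<in> jet_ring \<iota> u (Suc n)"
      by (rule map[OF Suc.IH p(2)])
    moreover have "poly (pderiv p) ((der ^^ n) u) \<in> jet_ring \<iota> u (Suc n)"
      by (rule subring_poly[OF subring_jet_ring _ jet_in_jet_ring])
        (intro jet_ring_Suc subring_coeff_pderiv[OF subring_jet_ring] p(2))
    moreover have "der ((der ^^ n) u) \<in> jet_ring \<iota> u (Suc (Suc n))"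
      using jet_in_jet_ring[of "Suc n"] by simp
    ultimately show ?case
      unfolding p(1) der_poly
      by (intro subringD(3,5)[OF subring_jet_ring]) (rule jet_ring_Suc jet_ring_Suc, assumption | assumption)+
  qed
  show "poly (map_poly der p) ((der ^^ n) u) \<in> jet_ring \<iota> u (Suc n)"
    if "\<And>i. coeff p i \<in> jet_ring \<iota> u n"
    by (rule map[OF der that])
qed

lemma jet_fieldI: "x \<in> jet_ring \<iota> u n \<Longrightarrow> y \<in> jet_ring \<iota> u n \<Longrightarrow> y \<noteq> 0 \<Longrightarrow> x / y \<in> jet_field \<iota> u n"
  by (auto simp: jet_field_def)

lemma jet_ring_subset_field: "x \<in> jet_ring \<iota> u n \<Longrightarrow> x \<in> jet_field \<iota> u n"
  using jet_fieldI[of x n 1] subringD(2)[OF subring_jet_ring] by simp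

lemma jet_field_ops:
  assumes "a \<in> jet_field \<iota> u n" "b \<in> jet_field \<iota> u n"
  shows "a + b \<in> jet_field \<iota> u n" "a * b \<in> jet_field \<iota> u n"
proof -
  obtain x y where a: "a = x / y" "x \<in> jet_ring \<iota> u n" "y \<in> jet_ring \<iota> u n" "y \<noteq> 0"
    using assms(1) by (auto simp: jet_field_def)
  obtain z w where b: "b = z / w" "z \<in> jet_ring \<iota> u n" "w \<in> jet_ring \<iota> u n" "w \<noteq> 0"
    using assms(2) by (auto simp: jet_field_def)
  note ops = subringD[OF subring_jet_ring]
  have "a + b = (x * w + z * y) / (y * w)" using a b by (simp add: add_frac_eq)
  also have "\<dots> \<in> jet_field \<iota> u n" using a b by (intro jet_fieldI) (auto intro: ops)
  finally show "a + b \<in> jet_field \<iota> u n" .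
  have "a * b = (x * z) / (y * w)" using a b by simp
  also have "\<dots> \<in> jet_field \<iota> u n" using a b by (intro jet_fieldI) (auto intro: ops)
  finally show "a * b \<in> jet_field \<iota> u n" .
qed

lemma jet_field_uminus_inverse:
  assumes "a \<in> jet_field \<iota> u n"
  shows "- a \<in> jet_field \<iota> u n" "inverse a \<in> jet_field \<iota> u n"
proof -
  obtain x y where a: "a = x / y" "x \<in> jet_ring \<iota> u n" "y \<in> jet_ring \<iota> u n" "y \<noteq> 0"
    using assms by (auto simp: jet_field_def)
  note ops = subringD[OF subring_jet_ring]
  have "- a = (0 - x) / y" using a by simp
  also have "\<dots> \<in> jet_field \<iota> u n" using a by (intro jet_fieldI) (auto intro: ops simp del: diff_0)
  finally show "- a \<in> jet_field \<iota> u n" .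
  show "inverse a \<in> jet_field \<iota> u n"
  proof (cases "x = 0")
    case True
    then show ?thesis using a jet_ring_subset_field ops(1) by simp
  next
    case False
    have "inverse a = y / x" using a by simp
    also have "\<dots> \<in> jet_field \<iota> u n" using a False by (intro jet_fieldI)
    finally show ?thesis .
  qed
qed

lemma jet_field_mono: "n \<le> m \<Longrightarrow> x \<in> jet_field \<iota> u n \<Longrightarrow> x \<in> jet_field \<iota> u m"
proof (induction m rule: dec_induct)
  case (step m)
  then show ?case unfolding jet_field_def using jet_ring_Suc by blast
qed

lemma jet_field_der: "x \<in> jet_field \<iota> u n \<Longrightarrow> der x \<in> jet_field \<iota> u (Suc n)"
proof -
  assume "x \<in> jet_field \<iota> u n"
  then obtain y z where x: "x = y / z" "y \<in> jet_ring \<iota> u n" "z \<in> jet_ring \<iota> u n" "z \<noteq> 0"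
    by (auto simp: jet_field_def)
  note ops = subringD[OF subring_jet_ring]
  show ?thesis
    unfolding x(1) der_divide[OF x(4)] using x
    by (intro jet_fieldI ops jet_ring_der jet_ring_Suc) simp_all
qed

lemma adjoin_subset_jet_fields: "adjoin \<iota> {u} \<subseteq> (\<Union>n. jet_field \<iota> u n)"
proof (rule adjoin_subset)
  show "diff_subfield (\<Union>n. jet_field \<iota> u n)"
    unfolding diff_subfield_def
  proof (intro conjI ballI)
    show "0 \<in> (\<Union>n. jet_field \<iota> u n)" "1 \<in> (\<Union>n. jet_field \<iota> u n)"
      using jet_ring_subset_field subringD(1,2)[OF subring_jet_ring] by blast+
  next
    fix a b assume "a \<in> (\<Union>n. jet_field \<iota> u n)" "b \<in> (\<Union>n. jet_field \<iota> u n)"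
    then obtain n m where "a \<in> jet_field \<iota> u n" "b \<in> jet_field \<iota> u m" by blast
    then have "a \<in> jet_field \<iota> u (max n m)" "b \<in> jet_field \<iota> u (max n m)"
      using jet_field_mono[of n "max n m"] jet_field_mono[of m "max n m"] by auto
    from jet_field_ops[OF this]
    show "a + b \<in> (\<Union>n. jet_field \<iota> u n)" "a * b \<in> (\<Union>n. jet_field \<iota> u n)"
      by blast+
  next
    fix a assume "a \<in> (\<Union>n. jet_field \<iota> u n)"
    then obtain n where "a \<in> jet_field \<iota> u n" by blast
    from jet_field_uminus_inverse[OF this] jet_field_der[OF this]
    show "- a \<in> (\<Union>n. jet_field \<iota> u n)" "inverse a \<in> (\<Union>n. jet_field \<iota> u n)"
      "der a \<in> (\<Union>n. jet_field \<iota> u n)"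
      by blast+
  qed
  show "range \<iota> \<subseteq> (\<Union>n. jet_field \<iota> u n)"
    using jet_ring_subset_field[of _ 0] by auto
  show "{u} \<subseteq> (\<Union>n. jet_field \<iota> u n)"
    using jet_ring_subset_field[OF jet_in_jet_ring[of 0]] by auto
qed

text \<open>
  An element of \<open>jet_ring \<iota> u n\<close> is the value at \<open>u\<close> of a differential polynomial of order less than \<open>n\<close>.
  That the variables from order \<open>n\<close> on do not occur is expressed by the fact that their values
  \<open>g ((), k)\<close> do not matter. They may be arbitrary polynomials over the ambient field, in particular
  an indeterminate for the variable of order \<open>n\<close>.
\<close>
lemma jet_ring_lift:
  assumes "x \<in> jet_ring \<iota> u n"
  shows "\<exists>P :: (unit, 'f) dpoly. \<forall>g. (\<forall>k<n. g ((), k) = [:(der ^^ k) u:]) \<longrightarrow>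
    peval (\<lambda>c. [:\<iota> c:]) g P = [:x:]"
  using assms
proof (induction n arbitrary: x)
  case 0
  interpret c: comm_ring_map "\<lambda>c. [:\<iota> c:]" by standard (simp_all add: one_pCons)
  obtain b where "x = \<iota> b" using 0 by auto
  then have "peval (\<lambda>c. [:\<iota> c:]) g (dconst b :: (unit, 'f) dpoly) = [:x:]" for g by simp
  then show ?case by blast
next
  case (Suc n)
  interpret c: comm_ring_map "\<lambda>c. [:\<iota> c:]" by standard (simp_all add: one_pCons)
  interpret k: comm_ring_map "\<lambda>c :: 'e. [:c:]" by standard (simp_all add: one_pCons)
  obtain p where p: "x = poly p ((der ^^ n) u)" "\<And>i. coeff p i \<in> jet_ring \<iota> u n"
    using Suc.prems by auto
  have "\<exists>Q. \<forall>i. \<forall>g. (\<forall>k<n. g ((), k) = [:(der ^^ k) u:]) \<longrightarrow>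
    peval (\<lambda>c. [:\<iota> c:]) g (Q i :: (unit, 'f) dpoly) = [:coeff p i:]"
    using Suc.IH[OF p(2)] by (intro choice) blast
  then obtain Q :: "nat \<Rightarrow> (unit, 'f) dpoly" where Q: "\<And>i g. (\<forall>k<n. g ((), k) = [:(der ^^ k) u:]) \<Longrightarrow>
    peval (\<lambda>c. [:\<iota> c:]) g (Q i) = [:coeff p i:]" by blast
  define P where "P = (\<Sum>i\<le>degree p. Q i * dvar ((), n) ^ i)"
  have "peval (\<lambda>c. [:\<iota> c:]) g P = [:x:]" if g: "\<forall>k<Suc n. g ((), k) = [:(der ^^ k) u:]" for g
  proof -
    interpret pe: comm_ring_map "peval (\<lambda>c. [:\<iota> c:]) g" by (rule c.comm_ring_map_peval)
    have "peval (\<lambda>c. [:\<iota> c:]) g P = (\<Sum>i\<le>degree p. [:coeff p i:] * [:(der ^^ n) u:] ^ i)"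
      unfolding P_def pe.h_sum using Q[of g] g by simp
    also have "\<dots> = [:x:]" unfolding p(1) poly_altdef by (simp only: k.h_sum k.h_mult k.h_power)
    finally show ?thesis .
  qed
  then show ?case by blast
qed

context
  assumes transc: "diff_transcendental \<iota> u"
begin

text \<open>
  Lifting the coefficients of \<open>p\<close> gives a differential polynomial that vanishes at \<open>u\<close> and is therefore
  zero. Evaluating it with an indeterminate in place of the \<open>n\<close>-th derivative recovers \<open>p\<close>.
\<close>
lemma jet_transcendental:
  assumes coeffs: "\<And>i. coeff p i \<in> jet_ring \<iota> u n" and root: "poly p ((der ^^ n) u) = 0"
  shows "p = 0"
proof -
  interpret c: comm_ring_map "\<lambda>c. [:\<iota> c:]" by standard (simp_all add: one_pCons)
  interpret k: comm_ring_map "\<lambda>c :: 'e. [:c:]" by standard (simp_all add: one_pCons)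
  have "\<exists>Q. \<forall>i. \<forall>g. (\<forall>k<n. g ((), k) = [:(der ^^ k) u:]) \<longrightarrow>
    peval (\<lambda>c. [:\<iota> c:]) g (Q i :: (unit, 'f) dpoly) = [:coeff p i:]"
    using jet_ring_lift[OF coeffs] by (intro choice) blast
  then obtain Q :: "nat \<Rightarrow> (unit, 'f) dpoly" where Q: "\<And>i g. (\<forall>k<n. g ((), k) = [:(der ^^ k) u:]) \<Longrightarrow>
    peval (\<lambda>c. [:\<iota> c:]) g (Q i) = [:coeff p i:]" by blast
  define P where "P = (\<Sum>i\<le>degree p. Q i * dvar ((), n) ^ i)"
  have eval: "peval (\<lambda>c. [:\<iota> c:]) (\<lambda>w. [:(der ^^ snd w) u:]) q = [:deval \<iota> der (\<lambda>_. u) q:]"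
    for q :: "(unit, 'f) dpoly"
    by (rule ring_map_eqI[where \<Psi> = "\<lambda>q. [:deval \<iota> der (\<lambda>_. u) q:]",
          OF c.comm_ring_map_peval comm_ring_map_comp[OF comm_ring_map_deval k.comm_ring_map_axioms]])
      simp_all
  have "deval \<iota> der (\<lambda>_. u) (Q i) = coeff p i" for i
    using eval[of "Q i"] Q[of "\<lambda>w. [:(der ^^ snd w) u:]" i] by simp
  then have "deval \<iota> der (\<lambda>_. u) P = poly p ((der ^^ n) u)"
    by (simp add: P_def deval.h_sum poly_altdef)
  then have "P = 0" using root transc by (simp add: diff_transcendental_def dpoly_eval_eq_deval)
  \<comment> \<open>An indeterminate for the derivative of order \<open>n\<close>, the derivatives of \<open>u\<close> for all others.\<close>
  define g where "g w = (if snd w = n then [:0, 1:] else [:(der ^^ snd w) u:])" for w :: "unit \<times> nat"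
  interpret pe: comm_ring_map "peval (\<lambda>c. [:\<iota> c:]) g" by (rule c.comm_ring_map_peval)
  have "peval (\<lambda>c. [:\<iota> c:]) g P = (\<Sum>i\<le>degree p. [:coeff p i:] * [:0, 1:] ^ i)"
    unfolding P_def pe.h_sum using Q[of g] by (simp add: g_def)
  also have "\<dots> = (\<Sum>i\<le>degree p. monom (coeff p i) i)"
    by (simp add: monom_altdef)
  also have "\<dots> = p" by (rule poly_as_sum_of_monoms)
  finally show ?thesis using \<open>P = 0\<close> by simp
qed

lemma jet_notin_jet_field: "(der ^^ n) u \<notin> jet_field \<iota> u n"
proof
  assume "(der ^^ n) u \<in> jet_field \<iota> u n"
  then obtain x y where xy: "(der ^^ n) u = x / y" "x \<in> jet_ring \<iota> u n" "y \<in> jet_ring \<iota> u n" "y \<noteq> 0"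
    by (auto simp: jet_field_def)
  note ops = subringD[OF subring_jet_ring]
  have "[:0 - x, y:] = 0"
    by (rule jet_transcendental[of _ n])
      (use xy in \<open>auto simp: coeff_pCons intro: ops split: nat.splits simp del: diff_0\<close>)
  then show False using xy by simp
qed

text \<open>
  For \<open>w = p(v) / q(v)\<close> with \<open>v\<close> the \<open>n\<close>-th derivative of \<open>u\<close>, the derivative of \<open>w\<close> is linear in
  \<open>der v\<close>, and its leading coefficient is the Wronskian of \<open>p\<close> and \<open>q\<close> at \<open>v\<close> divided by \<open>q(v)\<^sup>2\<close>. If it
  vanished, \<open>p\<close> and \<open>q\<close> would be proportional by transcendence of \<open>v\<close>, and \<open>w\<close> would be of lower order.
\<close>
lemma jet_field_der_leading:
  assumes w: "w \<in> jet_field \<iota> u (Suc n)" "w \<notin> jet_field \<iota> u n"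
  obtains \<alpha> \<beta> where "\<alpha> \<in> jet_field \<iota> u (Suc n)" "\<beta> \<in> jet_field \<iota> u (Suc n)" "\<alpha> \<noteq> 0"
    "der w = \<alpha> * (der ^^ Suc n) u + \<beta>"
proof -
  let ?u = "(der ^^ n) u"
  note ops = subringD[OF subring_jet_ring]
  obtain p q where p: "\<And>i. coeff p i \<in> jet_ring \<iota> u n" and q: "\<And>i. coeff q i \<in> jet_ring \<iota> u n"
    and w_eq: "w = poly p ?u / poly q ?u" and q0: "poly q ?u \<noteq> 0"
    using w(1) by (auto simp: jet_field_def)
  let ?x = "poly p ?u" and ?y = "poly q ?u"
  let ?W = "pderiv p * q - p * pderiv q"
  define \<alpha> where "\<alpha> = poly ?W ?u / (?y * ?y)"
  define \<beta> where "\<beta> = (poly (map_poly der p) ?u * ?y - ?x * poly (map_poly der q) ?u) / (?y * ?y)"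
  have W: "coeff ?W i \<in> jet_ring \<iota> u n" for i
    by (simp only: coeff_diff)
      (intro ops subring_coeff_mult subring_coeff_pderiv subring_jet_ring p q)
  have xy: "?x \<in> jet_ring \<iota> u (Suc n)" "?y \<in> jet_ring \<iota> u (Suc n)" "poly ?W ?u \<in> jet_ring \<iota> u (Suc n)"
    by (rule poly_in_jet_ring, rule p q W)+
  have "\<alpha> \<in> jet_field \<iota> u (Suc n)"
    unfolding \<alpha>_def using q0 by (intro jet_fieldI ops xy) simp
  moreover have "\<beta> \<in> jet_field \<iota> u (Suc n)"
    unfolding \<beta>_def using q0 by (intro jet_fieldI ops xy jet_ring_der_coeffs p q) simp
  moreover have "\<alpha> \<noteq> 0"
  proof
    assume "\<alpha> = 0"
    then have "poly ?W ?u = 0" using q0 by (simp add: \<alpha>_def)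
    then have "?W = 0" using jet_transcendental[OF W] by blast
    moreover have "q \<noteq> 0" using q0 by auto
    ultimately have "p = smult (lead_coeff p / lead_coeff q) q"
      by (intro wronskian_eq_0_imp_proportional) simp_all
    then have "?x = lead_coeff p / lead_coeff q * ?y" by (metis poly_smult)
    then have "w = lead_coeff p / lead_coeff q" using q0 by (simp add: w_eq)
    moreover have "lead_coeff p / lead_coeff q \<in> jet_field \<iota> u n"
      using p q \<open>q \<noteq> 0\<close> by (intro jet_fieldI) auto
    ultimately show False using w(2) by simp
  qed
  moreover have "der w = \<alpha> * (der ^^ Suc n) u + \<beta>"
    unfolding w_eq der_divide[OF q0] der_poly \<alpha>_def \<beta>_def
    by (simp add: add_divide_distrib[symmetric] algebra_simps)
  ultimately show ?thesis using that by blast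
qed

text \<open>
  Further derivatives keep the leading coefficient: the terms that arise from differentiating \<open>\<alpha>\<close> and
  \<open>\<gamma>\<close> have lower order.
\<close>
lemma jet_field_iterated_der_leading:
  assumes \<alpha>: "\<alpha> \<in> jet_field \<iota> u (Suc n)" and \<beta>: "\<beta> \<in> jet_field \<iota> u (Suc n)"
    and w: "der w = \<alpha> * (der ^^ Suc n) u + \<beta>"
  shows "\<exists>\<gamma>\<in>jet_field \<iota> u (Suc n + k). (der ^^ Suc k) w = \<alpha> * (der ^^ (Suc n + k)) u + \<gamma>"
proof (induction k)
  case 0
  then show ?case using w \<beta> by auto
next
  case (Suc k)
  then obtain \<gamma> where \<gamma>: "\<gamma> \<in> jet_field \<iota> u (Suc n + k)"
    and eq: "(der ^^ Suc k) w = \<alpha> * (der ^^ (Suc n + k)) u + \<gamma>" by blast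
  have "(der ^^ Suc (Suc k)) w
      = \<alpha> * (der ^^ (Suc n + Suc k)) u + (der \<alpha> * (der ^^ (Suc n + k)) u + der \<gamma>)"
    using arg_cong[OF eq, of der] by (simp add: der_add der_mult algebra_simps)
  moreover have "der \<alpha> * (der ^^ (Suc n + k)) u + der \<gamma> \<in> jet_field \<iota> u (Suc n + Suc k)"
  proof (intro jet_field_ops)
    show "der \<alpha> \<in> jet_field \<iota> u (Suc n + Suc k)"
      by (rule jet_field_mono[OF _ jet_field_der[OF \<alpha>]]) simp
    show "(der ^^ (Suc n + k)) u \<in> jet_field \<iota> u (Suc n + Suc k)"
      using jet_ring_subset_field[OF jet_in_jet_ring[of "Suc n + k"]] by simp
    show "der \<gamma> \<in> jet_field \<iota> u (Suc n + Suc k)"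
      using jet_field_der[OF \<gamma>] by simp
  qed
  ultimately show ?case by blast
qed

text \<open>
  If \<open>w\<close> had order \<open>n\<close> in \<open>u\<close>, the highest derivative of \<open>w\<close> in the equation would contain the derivative
  of \<open>u\<close> of order \<open>n + degree D\<close> linearly, and every other term has lower order. Solving the equation for
  this derivative of \<open>u\<close> contradicts its transcendence over the lower ones.
\<close>
lemma linear_ode_solution_in_base:
  assumes w: "w \<in> adjoin \<iota> {u}" and D: "degree D > 0" and sol: "act \<iota> der D w + \<iota> a = 0"
  shows "w \<in> range \<iota>"
proof (rule ccontr)
  assume not_base: "w \<notin> range \<iota>"
  define m where "m = (LEAST m. w \<in> jet_field \<iota> u m)"
  have "\<exists>m. w \<in> jet_field \<iota> u m" using w adjoin_subset_jet_fields by blast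
  then have m: "w \<in> jet_field \<iota> u m" unfolding m_def by (rule LeastI_ex)
  have "w \<notin> jet_field \<iota> u 0"
  proof
    assume "w \<in> jet_field \<iota> u 0"
    then obtain b c where bc: "w = \<iota> b / \<iota> c" "\<iota> c \<noteq> 0" by (auto simp: jet_field_def)
    then have "c \<noteq> 0" by auto
    then have "\<iota> (b / c) * \<iota> c = \<iota> b" by (simp flip: h_mult)
    then have "w = \<iota> (b / c)" using bc by (metis nonzero_eq_divide_eq)
    then show False using not_base by blast
  qed
  with m obtain n where n: "m = Suc n" by (cases m) auto
  have "w \<notin> jet_field \<iota> u n" using not_less_Least[of n "\<lambda>m. w \<in> jet_field \<iota> u m"] n m_def by auto
  with m n obtain \<alpha> \<beta> where \<alpha>: "\<alpha> \<in> jet_field \<iota> u (Suc n)" "\<alpha> \<noteq> 0"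
    and \<beta>: "\<beta> \<in> jet_field \<iota> u (Suc n)" and eq: "der w = \<alpha> * (der ^^ Suc n) u + \<beta>"
    using jet_field_der_leading by metis
  obtain e where e: "degree D = Suc e" using D by (cases "degree D") auto
  let ?N = "Suc n + e" and ?c = "lead_coeff D"
  obtain \<gamma> where \<gamma>: "\<gamma> \<in> jet_field \<iota> u ?N" "(der ^^ Suc e) w = \<alpha> * (der ^^ ?N) u + \<gamma>"
    using jet_field_iterated_der_leading[OF \<alpha>(1) \<beta> eq] by blast
  note ops = jet_field_ops[of _ ?N] jet_field_uminus_inverse[of _ ?N]
  have base: "\<iota> c \<in> jet_field \<iota> u ?N" for c
    by (rule jet_field_mono[OF _ jet_ring_subset_field[of _ 0]]) auto
  have "(der ^^ i) w \<in> jet_field \<iota> u (Suc n + i)" for i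
    by (induction i) (use m n jet_field_der in auto)
  then have low: "(der ^^ i) w \<in> jet_field \<iota> u ?N" if "i \<le> e" for i
    using jet_field_mono[of "Suc n + i" ?N] that by auto
  define s where "s = (\<Sum>i\<le>e. \<iota> (coeff D i) * (der ^^ i) w)"
  have s: "s \<in> jet_field \<iota> u ?N"
  proof -
    have "(\<Sum>i\<in>S. \<iota> (coeff D i) * (der ^^ i) w) \<in> jet_field \<iota> u ?N" if "finite S" "S \<subseteq> {..e}" for S
      using that
    proof (induction S)
      case (insert i S)
      have "(\<Sum>i\<in>insert i S. \<iota> (coeff D i) * (der ^^ i) w)
          = \<iota> (coeff D i) * (der ^^ i) w + (\<Sum>i\<in>S. \<iota> (coeff D i) * (der ^^ i) w)"
        using insert by simp
      also have "\<dots> \<in> jet_field \<iota> u ?N"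
        using insert low[of i] by (intro ops base) auto
      finally show ?case .
    qed (use base[of 0] in simp)
    then show ?thesis by (simp add: s_def)
  qed
  have "s + \<iota> ?c * (\<alpha> * (der ^^ ?N) u + \<gamma>) + \<iota> a = 0"
    using sol unfolding act_def e by (simp only: sum.atMost_Suc s_def[symmetric] \<gamma>(2) e)
  then have eq': "(\<iota> ?c * \<alpha>) * (der ^^ ?N) u = - (s + \<iota> ?c * \<gamma> + \<iota> a)"
    by (simp add: eq_neg_iff_add_eq_0 algebra_simps)
  have "D \<noteq> 0" using D by auto
  then have "\<iota> ?c \<noteq> 0" using embedding_eq_0[OF emb] by force
  then have nz: "\<iota> ?c * \<alpha> \<noteq> 0" using \<alpha>(2) by simp
  have cancel: "y = inverse x * (x * y)" if "x \<noteq> 0" for x y :: 'e using that by simp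
  have "(der ^^ ?N) u = inverse (\<iota> ?c * \<alpha>) * ((\<iota> ?c * \<alpha>) * (der ^^ ?N) u)"
    by (rule cancel[OF nz])
  also have "\<dots> = inverse (\<iota> ?c * \<alpha>) * - (s + \<iota> ?c * \<gamma> + \<iota> a)"
    by (simp only: eq')
  also have "\<dots> \<in> jet_field \<iota> u ?N"
    by (intro ops base s \<gamma>(1) jet_field_mono[of "Suc n" ?N, OF _ \<alpha>(1)]) simp
  finally show False using jet_notin_jet_field by blast
qed

end

end

section \<open>Unirational linear curves have coprime operators\<close>

text \<open>
  Let \<open>n = degree D\<close>. On the polynomial ring with variables \<open>z 0, z 1, \<dots>\<close> take the derivation with
  \<open>z i \<mapsto> z (i + 1)\<close> for \<open>i + 1 < n\<close> and \<open>z (n - 1) \<mapsto> - (\<Sum>i<n. c\<^sub>i z i)\<close>, with \<open>c\<^sub>i\<close> the coefficients of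
  \<open>D\<close>. Then \<open>z 0\<close> is a nonzero solution of \<open>D = 0\<close>. The Bezout identity lifts \<open>z 0 + b\<close> to a point with
  \<open>E1(x) + E2(y) = z 0 + b\<close>. The linear differential polynomial on the right vanishes at this point,
  hence so does the ideal it generates, but the one on the left has the value \<open>z 0\<close>.
\<close>
lemma factor_notin_diff_ideal:
  fixes D E1 E2 U V :: "'f::differential_field poly"
  assumes D: "lead_coeff D = 1" "degree D > 0"
    and bezout: "E1 \<star> U + E2 \<star> V = 1"
    and b: "act (\<lambda>c. c) der D b + a = 0"
  shows "linear_dpoly E1 E2 (- b) \<notin> diff_ideal_gen {linear_dpoly (D \<star> E1) (D \<star> E2) a}"
proof
  assume mem: "linear_dpoly E1 E2 (- b) \<in> diff_ideal_gen {linear_dpoly (D \<star> E1) (D \<star> E2) a}"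
  define n where "n = degree D"
  define z :: "nat \<Rightarrow> (unit, 'f) dpoly" where "z i = dvar ((), i)" for i
  define s :: "unit \<times> nat \<Rightarrow> (unit, 'f) dpoly" where
    "s w = (if Suc (snd w) < n then z (Suc (snd w)) else - (\<Sum>i<n. dconst (coeff D i) * z i))" for w
  let ?d = "der_with s"
  interpret diff_map "dconst :: 'f \<Rightarrow> (unit, 'f) dpoly" ?d by (rule diff_map_der_with)
  have iter: "(?d ^^ i) (z 0) = z i" if "i < n" for i
    using that by (induction i) (simp_all add: z_def s_def)
  obtain k where k: "n = Suc k" using D(2) by (cases n) (auto simp: n_def)
  have "(?d ^^ n) (z 0) = - (\<Sum>i<n. dconst (coeff D i) * z i)"
    using iter[of k] by (simp add: k) (simp add: z_def s_def k)
  moreover have "act dconst ?d D (z 0) = (\<Sum>i<n. dconst (coeff D i) * z i) + dconst (coeff D n) * (?d ^^ n) (z 0)"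
    unfolding act_def n_def[symmetric] by (simp add: iter flip: lessThan_Suc_atMost)
  moreover have "coeff D n = 1" using D(1) by (simp add: n_def)
  ultimately have Dz: "act dconst ?d D (z 0) = 0" by simp
  define x where "x = z 0 + dconst b"
  define \<eta> where "\<eta> v = (case v of X \<Rightarrow> act dconst ?d U x | Y \<Rightarrow> act dconst ?d V x)" for v
  have "act dconst ?d E1 (\<eta> X) + act dconst ?d E2 (\<eta> Y) = act dconst ?d (E1 \<star> U + E2 \<star> V) x"
    by (simp add: \<eta>_def act_add_left act_op_mult)
  then have E: "act dconst ?d E1 (\<eta> X) + act dconst ?d E2 (\<eta> Y) = x"
    by (simp add: bezout)
  have "deval dconst ?d \<eta> (linear_dpoly (D \<star> E1) (D \<star> E2) a) = act dconst ?d D x + dconst a"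
    by (simp add: deval_linear_dpoly act_op_mult flip: E act_add_right)
  also have "\<dots> = dconst (act (\<lambda>c. c) der D b + a)"
    by (simp add: x_def act_add_right Dz act_base)
  finally have "deval dconst ?d \<eta> (linear_dpoly (D \<star> E1) (D \<star> E2) a) = 0" by (simp add: b)
  from deval_diff_ideal_gen[OF this mem] have "z 0 = 0"
    by (simp add: deval_linear_dpoly E) (simp add: x_def)
  moreover have "Poly_Mapping.lookup (z 0) (Poly_Mapping.single ((), 0) 1) = 1"
    by (simp add: z_def dvar_def)
  ultimately show False by simp
qed

text \<open>
  A common left divisor \<open>D\<close> of positive degree yields the solution \<open>E1(P1) + E2(P2)\<close> of \<open>D(w) + a = 0\<close> in
  the field generated by \<open>u\<close>. It lies in the base field, which gives a relation between the coordinates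
  of \<open>P\<close> outside the ideal of the curve.
\<close>
lemma unirational_imp_coprime:
  fixes \<iota> :: "'f::differential_field \<Rightarrow> 'e::differential_field"
  assumes emb: "diff_embedding \<iota>" and transc: "diff_transcendental \<iota> u" and r: "ranking r"
    and nonconst: "linear_dpoly L1 L2 a \<notin> range dconst"
    and param: "rational_parametrization \<iota> u r (linear_dpoly L1 L2 a) P"
  shows "gcld L1 L2 = 1"
proof (rule ccontr)
  assume not_1: "gcld L1 L2 \<noteq> 1"
  define D where "D = gcld L1 L2"
  let ?F = "linear_dpoly L1 L2 a"
  interpret diff_map \<iota> der using emb by (rule diff_map_embedding)
  obtain U V M1 M2 E1 E2 N1 N2 where monic: "lead_coeff D = 1"
    and red: "unimodular_reduction L1 L2 D U V M1 M2 E1 E2 N1 N2"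
    unfolding D_def
    using gcld_unimodular_reduction[OF linear_dpoly_nonconst_operators[OF nonconst]] by blast
  have L: "L1 = D \<star> E1" "L2 = D \<star> E2" and bezout: "E1 \<star> U + E2 \<star> V = 1"
    using red by (auto simp: unimodular_reduction_def)
  have deg: "degree D > 0"
  proof (rule ccontr)
    assume "\<not> degree D > 0"
    then have "degree D = 0" by simp
    then obtain c where "D = [:c:]" by (rule degree_eq_zeroE)
    then have "D = 1" using monic by (simp add: one_pCons)
    then show False using not_1 by (simp add: D_def)
  qed
  have I: "vanishing_ideal \<iota> P = diff_ideal_gen {?F}"
    and P: "range P \<subseteq> adjoin \<iota> {u}"
    using param sat_linear_dpoly[OF r nonconst] by (auto simp: rational_parametrization_def)
  define w where "w = deval \<iota> der P (linear_dpoly E1 E2 0)"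
  have w: "w = act \<iota> der E1 (P X) + act \<iota> der E2 (P Y)"
    by (simp add: w_def deval_linear_dpoly)
  have "?F \<in> vanishing_ideal \<iota> P" unfolding I using subset_diff_ideal_gen by blast
  then have "deval \<iota> der P ?F = 0" by (simp add: vanishing_ideal_def dpoly_eval_eq_deval)
  then have Dw: "act \<iota> der D w + \<iota> a = 0"
    by (simp add: deval_linear_dpoly L act_op_mult w act_add_right)
  have "w \<in> adjoin \<iota> {u}" unfolding w_def by (rule deval_in_adjoin[OF emb P])
  then obtain b where b: "w = \<iota> b"
    using linear_ode_solution_in_base[OF emb transc _ deg Dw] by blast
  have "\<iota> (act (\<lambda>c. c) der D b + a) = 0" using Dw by (simp add: b act_base)
  then have "act (\<lambda>c. c) der D b + a = 0" by (rule embedding_eq_0[OF emb])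
  from factor_notin_diff_ideal[OF monic deg bezout this]
  have "linear_dpoly E1 E2 (- b) \<notin> vanishing_ideal \<iota> P" by (simp add: I L)
  moreover have "deval \<iota> der P (linear_dpoly E1 E2 (- b)) = 0"
    using w b by (simp add: deval_linear_dpoly)
  ultimately show False by (simp add: vanishing_ideal_def dpoly_eval_eq_deval)
qed

theorem theorem5p4:
  fixes \<iota> :: "'f::differential_field \<Rightarrow> 'e::differential_field"
    and u :: 'e
    and r :: "(indet \<times> nat) rel"
    and L1 L2 :: "'f poly"
    and a :: 'f
    and F :: "(indet, 'f) dpoly"
  assumes "universal_extension \<iota>"
    and "diff_transcendental \<iota> u"
    and "ranking r"
    and "F = op_apply L1 X + op_apply L2 Y + dconst a"
    and "F \<notin> range dconst"
  shows "(unirational \<iota> u r F \<longleftrightarrow> gcld L1 L2 = 1) \<and>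
    (\<forall>A :: (indet, 'f) dpoly. linear_curve A \<and> unirational \<iota> u r A \<longrightarrow>
       (\<exists>P. rational_parametrization \<iota> u r A P \<and> proper \<iota> u P \<and> linear_polynomial_point \<iota> u P))"
proof -
  have emb: "diff_embedding \<iota>" using assms(1) by (simp add: universal_extension_def)
  have F: "F = linear_dpoly L1 L2 a" by (simp add: assms(4) linear_dpoly_def)
  have nonconst: "linear_dpoly L1 L2 a \<notin> range dconst" using assms(5) by (simp add: F)
  have "irreducible_curve F"
    unfolding F irreducible_curve_def using nonconst irreducible_linear_dpoly by blast
  then have "unirational \<iota> u r F \<longleftrightarrow> gcld L1 L2 = 1"
    using unirational_imp_coprime[OF emb assms(2,3) nonconst]
      proper_parametrization[OF emb assms(2,3) nonconst]
    by (auto simp: unirational_def F)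
  moreover have "\<exists>P. rational_parametrization \<iota> u r A P \<and> proper \<iota> u P \<and> linear_polynomial_point \<iota> u P"
    if A: "linear_curve A" "unirational \<iota> u r A" for A :: "(indet, 'f) dpoly"
  proof -
    have "total_degree A \<le> 1" using A(1) by (simp add: linear_curve_def)
    then obtain K1 K2 c where K: "A = linear_dpoly K1 K2 c" by (rule total_degree_1_linear_dpoly)
    have nonconst': "linear_dpoly K1 K2 c \<notin> range dconst"
      using A(1) by (auto simp: linear_curve_def irreducible_curve_def K)
    obtain P where "rational_parametrization \<iota> u r (linear_dpoly K1 K2 c) P"
      using A(2) by (auto simp: unirational_def K)
    then have "gcld K1 K2 = 1" by (rule unirational_imp_coprime[OF emb assms(2,3) nonconst'])
    then show ?thesis unfolding K by (rule proper_parametrization[OF emb assms(2,3) nonconst'])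
  qed
  ultimately show ?thesis by blast
qed

end
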